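(* Let $\mathbb G=\mathbb G^{[3]}$ and $\alpha,\beta,\gamma\in\mathbb Z_{\ge0}$. Let $\mathfrak a\in K(\alpha)\backslash\mathbb G/K(\beta)$ and $\mathfrak b\in K(\beta)\backslash\mathbb G/K(\gamma)$. Choose $\mathbf p\in\mathfrak a$, $\mathbf q\in\mathfrak b$ and a weak zero $(h_j)_{j\ge1}$ in $K(\beta)$. Then the double coset $$\mathfrak c_j:=K(\alpha)\,\mathbf p\,h_j\,\mathbf q\,K(\gamma)$$ equals $\mathfrak a\circ\mathfrak b$ for all sufficiently large $j$.
   Context: Group. $S_\infty$ is the group of all permutations of $\mathbb N=\{1,2,\dots\}$; $S_\infty(\alpha)$ is the pointwise stabilizer of $1,\dots,\alpha$ ($S_\infty(0)=S_\infty$); $S_\infty^{fin}$ is the subgroup of finitely supported permutations. $\mathbb G=\mathbb G^{[3]}$ is the group of triples $(g_{red},g_{yellow},g_{blue})\in S_\infty^3$ such that $g_ig_j^{-1}\in S_\infty^{fin}$ for all $i,j$. $K\subset\mathbb G$ is the diagonal copy of $S_\infty$ and $K(\alpha)\subset K$ the diagonal copy of $S_\infty(\alpha)$. Products of permutations are compositions, the right factor acting first. Weak zero. Writing elements of $K\simeq S_\infty$ as infinite $0$-$1$ matrices, a sequence $h_j\in K(\beta)$ is a weak zero if it converges entrywise to the $(\beta+\infty)\times(\beta+\infty)$ matrix $\begin{pmatrix}1&0\\0&0\end{pmatrix}$; that is, for all $k,m>\beta$ one has $h_j(k)\neq m$ for all sufficiently large $j$. Boards. An $(\alpha,\beta)$-board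 is a compact closed oriented (possibly disconnected or empty) triangulated surface, up to isomorphism, whose triangles are colored black and white so that neighbors have opposite colors, whose edges are colored red, yellow, blue so that each black (white) triangle has one edge of each color, in the cyclic order red, yellow, blue anticlockwise (clockwise), together with labels $1,\dots,\beta$ assigned to distinct black triangles and $1,\dots,\alpha$ assigned to distinct white triangles (other triangles are unlabeled), such that no component is an empty cheburek. A cheburek is a component consisting of one black and one white triangle glued along all three edges of the same colors; it is empty if neither triangle is labeled. Equivalently, a board consists of finite sets of black and white triangles and, for each color, a bijection from black to white triangles (adjacency along the edge of that color), plus labels. Double cosets as boards. To $\mathbf g\in\mathbb G$ associate black triangles $A_i$ and white triangles $B_i$, $i\in\mathbb N$, and for each color $c$ glue the $c$-edge of $A_i$ to the $c$-edge of $B_{g_c(i)}$; then forget the numbers $>\beta$ on black and $>\alpha$ on white triangles and delete all empty chebureks. This gives a bijection between $K(\alpha)\backslash\mathbb G/K(\beta)$ and the set of $(\alpha,\beta)$-boards, and the two sets are identified. Multiplication. For an $(\alpha,\beta)$-board $\mathfrak a$ and a $(\beta,\gamma)$-board $\mathfrak b$, the $(\alpha,\gamma)$-board $\mathfrak a\circ\mathfrak b$ is obtained as follows: for each $j=1,\dots,\beta$ cut out the black triangle of $\mathfrak a$ with label $j$ and the white triangle of $\mathfrak b$ with label $j$, and glue the perimeters of the two holes according to colors and orientations of edges; keep the remaining labels ($1,\dots,\alpha$ on white triangles coming from $\mathfrak a$, $1,\dots,\gamma$ on black triangles coming from $\mathfrak b$) and discard empty chebureks. *)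

theory Defs
  imports Complex_Main "HOL-Library.Countable_Set" "HOL-Combinatorics.Permutations"
    "HOL-Algebra.Coset"
begin

section \<open>The group and its double cosets\<close>

datatype color = Red | Yellow | Blue

text \<open>
  The set \<open>{1, 2, \<dots>}\<close> is \<open>{1..}\<close> in \<^typ>\<open>nat\<close>; a permutation of it is a function on \<^typ>\<open>nat\<close>
  with \<open>\<sigma> permutes {1..}\<close>, hence fixing \<open>0\<close>.
\<close>

definition S_inf :: "nat \<Rightarrow> (nat \<Rightarrow> nat) set" where
  "S_inf \<alpha> = {\<sigma>. \<sigma> permutes {1..} \<and> (\<forall>i\<in>{1..\<alpha>}. \<sigma> i = i)}"

definition S_fin :: "(nat \<Rightarrow> nat) set" where
  "S_fin = {\<sigma> \<in> S_inf 0. finite {i. \<sigma> i \<noteq> i}}"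

type_synonym triple = "color \<Rightarrow> nat \<Rightarrow> nat"

definition GG :: "triple monoid" where
  "GG = \<lparr>carrier = {g. (\<forall>c. g c \<in> S_inf 0) \<and> (\<forall>c d. g c \<circ> inv_into UNIV (g d) \<in> S_fin)},
         mult = (\<lambda>g h c. g c \<circ> h c),
         one = (\<lambda>c. id)\<rparr>"

definition K :: "nat \<Rightarrow> triple set" where
  "K \<alpha> = (\<lambda>\<sigma> c. \<sigma>) ` S_inf \<alpha>"

definition double_coset :: "nat \<Rightarrow> nat \<Rightarrow> triple \<Rightarrow> triple set" where
  "double_coset \<alpha> \<beta> g = (K \<alpha> #>\<^bsub>GG\<^esub> g) <#>\<^bsub>GG\<^esub> K \<beta>"

definition double_cosets :: "nat \<Rightarrow> nat \<Rightarrow> triple set set" where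
  "double_cosets \<alpha> \<beta> = double_coset \<alpha> \<beta> ` carrier GG"

definition perm_matrix :: "(nat \<Rightarrow> nat) \<Rightarrow> nat \<Rightarrow> nat \<Rightarrow> real" where
  "perm_matrix \<sigma> m k = (if \<sigma> k = m then 1 else 0)"

definition weak_zero :: "nat \<Rightarrow> (nat \<Rightarrow> triple) \<Rightarrow> bool" where
  "weak_zero \<beta> h \<longleftrightarrow> (\<forall>j. h j \<in> K \<beta>) \<and>
     (\<forall>c. \<forall>m\<ge>1. \<forall>k\<ge>1. (\<lambda>j. perm_matrix (h j c) m k) \<longlonglongrightarrow> (if m = k \<and> k \<le> \<beta> then 1 else 0))"


section \<open>Boards\<close>

text \<open>
  A board is given combinatorially: \<open>glue X c b\<close> is the white triangle adjacent to the black
  triangle \<open>b\<close> along the edge of color \<open>c\<close>. The orientations of the triangles are determined by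
  their colors. In the context of \<open>(\<alpha>, \<beta>)\<close>-boards only the values of \<open>black_label\<close> on \<open>{1..\<beta>}\<close>
  and of \<open>white_label\<close> on \<open>{1..\<alpha>}\<close> are relevant.
\<close>

record ('b, 'w) board =
  black :: "'b set"
  white :: "'w set"
  glue :: "color \<Rightarrow> 'b \<Rightarrow> 'w"
  black_label :: "nat \<Rightarrow> 'b"
  white_label :: "nat \<Rightarrow> 'w"

definition empty_cheburek :: "nat \<Rightarrow> nat \<Rightarrow> ('b, 'w) board \<Rightarrow> 'b \<Rightarrow> 'w \<Rightarrow> bool" where
  "empty_cheburek \<alpha> \<beta> X b w \<longleftrightarrow>
     b \<in> black X \<and> w \<in> white X \<and> (\<forall>c. glue X c b = w) \<and>
     b \<notin> black_label X ` {1..\<beta>} \<and> w \<notin> white_label X ` {1..\<alpha>}"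

definition discard :: "nat \<Rightarrow> nat \<Rightarrow> ('b, 'w) board \<Rightarrow> ('b, 'w) board" where
  "discard \<alpha> \<beta> X = X\<lparr>black := {b \<in> black X. \<nexists>w. empty_cheburek \<alpha> \<beta> X b w},
                      white := {w \<in> white X. \<nexists>b. empty_cheburek \<alpha> \<beta> X b w}\<rparr>"

definition is_board :: "nat \<Rightarrow> nat \<Rightarrow> ('b, 'w) board \<Rightarrow> bool" where
  "is_board \<alpha> \<beta> X \<longleftrightarrow>
     finite (black X) \<and> finite (white X) \<and>
     (\<forall>c. bij_betw (glue X c) (black X) (white X)) \<and>
     inj_on (black_label X) {1..\<beta>} \<and> black_label X ` {1..\<beta>} \<subseteq> black X \<and>
     inj_on (white_label X) {1..\<alpha>} \<and> white_label X ` {1..\<alpha>} \<subseteq> white X \<and>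
     (\<nexists>b w. empty_cheburek \<alpha> \<beta> X b w)"

definition board_iso :: "nat \<Rightarrow> nat \<Rightarrow> ('b1, 'w1) board \<Rightarrow> ('b2, 'w2) board \<Rightarrow> bool" where
  "board_iso \<alpha> \<beta> X Y \<longleftrightarrow> (\<exists>f g.
     bij_betw f (black X) (black Y) \<and> bij_betw g (white X) (white Y) \<and>
     (\<forall>c. \<forall>b\<in>black X. glue Y c (f b) = g (glue X c b)) \<and>
     (\<forall>j\<in>{1..\<beta>}. f (black_label X j) = black_label Y j) \<and>
     (\<forall>j\<in>{1..\<alpha>}. g (white_label X j) = white_label Y j))"

text \<open>
  Every board is isomorphic to one whose triangles are natural numbers, so isomorphism classes
  of boards are taken among those.
\<close>

definition boards :: "nat \<Rightarrow> nat \<Rightarrow> (nat, nat) board set set" where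
  "boards \<alpha> \<beta> = {X. is_board \<alpha> \<beta> X} //
     {(X, Y). is_board \<alpha> \<beta> X \<and> is_board \<alpha> \<beta> Y \<and> board_iso \<alpha> \<beta> X Y}"

definition board_class :: "nat \<Rightarrow> nat \<Rightarrow> ('b, 'w) board \<Rightarrow> (nat, nat) board set" where
  "board_class \<alpha> \<beta> X = {Y. is_board \<alpha> \<beta> Y \<and> board_iso \<alpha> \<beta> X Y}"

definition board_of :: "nat \<Rightarrow> nat \<Rightarrow> triple \<Rightarrow> (nat, nat) board" where
  "board_of \<alpha> \<beta> g = discard \<alpha> \<beta>
     \<lparr>black = {1..}, white = {1..}, glue = g, black_label = id, white_label = id\<rparr>"

text \<open>The identification of double cosets with boards; see \<open>bij_betw_coset_board\<close> below.\<close>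

definition coset_board :: "nat \<Rightarrow> nat \<Rightarrow> triple set \<Rightarrow> (nat, nat) board set" where
  "coset_board \<alpha> \<beta> A = (\<Union>g\<in>A. board_class \<alpha> \<beta> (board_of \<alpha> \<beta> g))"


section \<open>Multiplication of boards\<close>

text \<open>
  The black triangle of \<open>X\<close> and the white triangle of \<open>Y\<close> with the same label \<open>j\<close> are cut out, and
  the perimeters of the holes are glued: a black triangle of \<open>Y\<close> whose \<open>c\<close>-edge was adjacent to
  the removed white triangle becomes adjacent, along that edge, to the white triangle of \<open>X\<close>
  that was adjacent to the \<open>c\<close>-edge of the removed black triangle.
\<close>

definition glue_boards ::
    "nat \<Rightarrow> ('b1, 'w1) board \<Rightarrow> ('b2, 'w2) board \<Rightarrow> ('b1 + 'b2, 'w1 + 'w2) board" where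
  "glue_boards \<beta> X Y =
    \<lparr>black = Inl ` (black X - black_label X ` {1..\<beta>}) \<union> Inr ` black Y,
     white = Inl ` white X \<union> Inr ` (white Y - white_label Y ` {1..\<beta>}),
     glue = (\<lambda>c t. case t of
         Inl b \<Rightarrow> Inl (glue X c b)
       | Inr b \<Rightarrow>
           (let w = glue Y c b in
            if w \<in> white_label Y ` {1..\<beta>}
            then Inl (glue X c (black_label X (inv_into {1..\<beta>} (white_label Y) w)))
            else Inr w)),
     black_label = (\<lambda>j. Inr (black_label Y j)),
     white_label = (\<lambda>j. Inl (white_label X j))\<rparr>"

definition board_mult :: "nat \<Rightarrow> nat \<Rightarrow> nat \<Rightarrow>
    (nat, nat) board set \<Rightarrow> (nat, nat) board set \<Rightarrow> (nat, nat) board set" where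
  "board_mult \<alpha> \<beta> \<gamma> A B =
     (\<Union>X\<in>A. \<Union>Y\<in>B. board_class \<alpha> \<gamma> (discard \<alpha> \<gamma> (glue_boards \<beta> X Y)))"

definition coset_mult :: "nat \<Rightarrow> nat \<Rightarrow> nat \<Rightarrow> triple set \<Rightarrow> triple set \<Rightarrow> triple set" where
  "coset_mult \<alpha> \<beta> \<gamma> A B =
     inv_into (double_cosets \<alpha> \<gamma>) (coset_board \<alpha> \<gamma>)
       (board_mult \<alpha> \<beta> \<gamma> (coset_board \<alpha> \<beta> A) (coset_board \<beta> \<gamma> B))"


section \<open>The definitions fit together\<close>

lemma S_inf_0: "S_inf 0 = {\<sigma>. \<sigma> permutes {1..}}"
  by (auto simp: S_inf_def)

lemma S_inf_comp: "\<sigma> \<in> S_inf \<alpha> \<Longrightarrow> \<tau> \<in> S_inf \<alpha> \<Longrightarrow> \<sigma> \<circ> \<tau> \<in> S_inf \<alpha>"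
  by (auto simp: S_inf_def intro: permutes_compose)

lemma S_inf_inv: "\<sigma> \<in> S_inf \<alpha> \<Longrightarrow> inv_into UNIV \<sigma> \<in> S_inf \<alpha>"
  by (auto simp: S_inf_def permutes_inv permutes_inv_eq)

lemma S_inf_id: "id \<in> S_inf \<alpha>"
  by (auto simp: S_inf_def permutes_id)

lemma S_inf_mono: "\<sigma> \<in> S_inf \<alpha> \<Longrightarrow> \<sigma> \<in> S_inf 0"
  by (auto simp: S_inf_def)

lemma bij_S_inf: "\<sigma> \<in> S_inf \<alpha> \<Longrightarrow> bij \<sigma>"
  by (auto simp: S_inf_def permutes_bij)

lemma carrier_GG_iff:
  "g \<in> carrier GG \<longleftrightarrow> (\<forall>c. g c permutes {1..}) \<and> (\<forall>c d. finite {i. g c i \<noteq> g d i})"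
proof -
  have fin: "finite {i. (g c \<circ> inv_into UNIV (g d)) i \<noteq> i} \<longleftrightarrow> finite {i. g c i \<noteq> g d i}"
    if "bij (g d)" for c d
  proof -
    have "{i. (g c \<circ> inv_into UNIV (g d)) i \<noteq> i} = g d ` {i. g c i \<noteq> g d i}"
      using that by (auto simp: image_iff bij_is_inj bij_is_surj surj_f_inv_f inv_f_f) 
        (metis bij_inv_eq_iff)
    moreover have "inj_on (g d) {i. g c i \<noteq> g d i}"
      using that by (meson bij_is_inj inj_on_subset top_greatest)
    ultimately show ?thesis by (simp add: finite_image_iff)
  qed
  show ?thesis
  proof
    assume *: "g \<in> carrier GG"
    then have "bij (g c)" for c by (auto simp: GG_def S_inf_0 intro: permutes_bij)
    with * show "(\<forall>c. g c permutes {1..}) \<and> (\<forall>c d. finite {i. g c i \<noteq> g d i})"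
      using fin by (simp add: GG_def S_fin_def S_inf_0 del: o_apply)
  next
    assume *: "(\<forall>c. g c permutes {1..}) \<and> (\<forall>c d. finite {i. g c i \<noteq> g d i})"
    then have "finite {i. (g c \<circ> inv_into UNIV (g d)) i \<noteq> i}" for c d
      using fin permutes_bij by blast
    with * show "g \<in> carrier GG"
      by (simp add: GG_def S_fin_def S_inf_0 permutes_compose permutes_inv del: o_apply)
  qed
qed

lemma group_GG: "group GG"
proof (rule groupI)
  fix x y assume "x \<in> carrier GG" "y \<in> carrier GG"
  then have x: "x c permutes {1..}" "finite {i. x c i \<noteq> x d i}"
    and y: "y c permutes {1..}" "finite {i. y c i \<noteq> y d i}" for c d
    by (auto simp: carrier_GG_iff)
  have "finite {i. (x c \<circ> y c) i \<noteq> (x d \<circ> y d) i}" for c d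
  proof (rule finite_subset)
    show "{i. (x c \<circ> y c) i \<noteq> (x d \<circ> y d) i} \<subseteq>
        y c -` {i. x c i \<noteq> x d i} \<union> {i. y c i \<noteq> y d i}"
      by auto
    show "finite (y c -` {i. x c i \<noteq> x d i} \<union> {i. y c i \<noteq> y d i})"
      using x y by (meson finite_UnI finite_vimageI permutes_inj)
  qed
  then show "x \<otimes>\<^bsub>GG\<^esub> y \<in> carrier GG"
    using x y unfolding carrier_GG_iff by (simp add: GG_def permutes_compose del: o_apply)
next
  show "\<one>\<^bsub>GG\<^esub> \<in> carrier GG"
    unfolding carrier_GG_iff by (simp add: GG_def permutes_id)
next
  fix x assume "x \<in> carrier GG"
  then have x: "x c permutes {1..}" "finite {i. x c i \<noteq> x d i}" for c d
    by (auto simp: carrier_GG_iff)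
  let ?y = "\<lambda>c. inv_into UNIV (x c)"
  have "finite {i. ?y c i \<noteq> ?y d i}" for c d
  proof (rule finite_subset)
    show "{i. ?y c i \<noteq> ?y d i} \<subseteq> x c ` {i. x c i \<noteq> x d i}"
    proof
      fix i assume "i \<in> {i. ?y c i \<noteq> ?y d i}"
      then have "x d (?y c i) \<noteq> i" "x c (?y c i) = i"
        using permutes_inverses[OF x(1)[of c]] permutes_inverses[OF x(1)[of d]] by auto metis
      then show "i \<in> x c ` {i. x c i \<noteq> x d i}"
        by (metis (mono_tags, lifting) image_eqI mem_Collect_eq)
    qed
  qed (use x in auto)
  then have "?y \<in> carrier GG"
    using x unfolding carrier_GG_iff by (simp add: permutes_inv)
  moreover have "?y \<otimes>\<^bsub>GG\<^esub> x = \<one>\<^bsub>GG\<^esub>"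
    using permutes_inv_o(2)[OF x(1)] by (simp add: GG_def)
  ultimately show "\<exists>y\<in>carrier GG. y \<otimes>\<^bsub>GG\<^esub> x = \<one>\<^bsub>GG\<^esub>" by blast
qed (auto simp: GG_def comp_assoc)

lemma weak_zero_iff:
  "weak_zero \<beta> h \<longleftrightarrow> (\<forall>j. h j \<in> K \<beta>) \<and>
     (\<forall>c. \<forall>k>\<beta>. \<forall>m>\<beta>. \<forall>\<^sub>F j in sequentially. h j c k \<noteq> m)"
proof (cases "\<forall>j. h j \<in> K \<beta>")
  case True
  then have S: "h j c \<in> S_inf \<beta>" for j c
    unfolding K_def image_iff by metis
  have fix_le: "h j c k = k" if "k \<ge> 1" "k \<le> \<beta>" for j c k
    using S[of j c] that by (auto simp: S_inf_def)
  have inj: "h j c k = h j c m \<longleftrightarrow> k = m" for j c k m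
    using bij_S_inf[OF S[of j c]] by (metis bij_pointE)
  have lim0: "(\<lambda>j. perm_matrix (h j c) m k) \<longlonglongrightarrow> 0 \<longleftrightarrow> (\<forall>\<^sub>F j in sequentially. h j c k \<noteq> m)"
    for c m k
  proof
    assume "(\<lambda>j. perm_matrix (h j c) m k) \<longlonglongrightarrow> 0"
    then have "\<forall>\<^sub>F j in sequentially. perm_matrix (h j c) m k < 1"
      by (rule order_tendstoD) simp
    then show "\<forall>\<^sub>F j in sequentially. h j c k \<noteq> m"
      by eventually_elim (auto simp: perm_matrix_def)
  next
    assume "\<forall>\<^sub>F j in sequentially. h j c k \<noteq> m"
    then show "(\<lambda>j. perm_matrix (h j c) m k) \<longlonglongrightarrow> 0"
      by (intro tendsto_eventually) (auto simp: perm_matrix_def elim: eventually_mono)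
  qed
  have small: "(\<lambda>j. perm_matrix (h j c) m k) \<longlonglongrightarrow> (if m = k \<and> k \<le> \<beta> then 1 else 0)"
    if "m \<ge> 1" "k \<ge> 1" "m \<le> \<beta> \<or> k \<le> \<beta>" for c m k
  proof -
    have "perm_matrix (h j c) m k = (if m = k \<and> k \<le> \<beta> then 1 else 0)" for j
      using that fix_le[of k j c] fix_le[of m j c] inj[of j c k m]
      by (auto simp: perm_matrix_def)
    then show ?thesis by simp
  qed
  have "(\<forall>c. \<forall>m\<ge>1. \<forall>k\<ge>1. (\<lambda>j. perm_matrix (h j c) m k) \<longlonglongrightarrow>
           (if m = k \<and> k \<le> \<beta> then 1 else 0)) \<longleftrightarrow>
        (\<forall>c. \<forall>k>\<beta>. \<forall>m>\<beta>. (\<lambda>j. perm_matrix (h j c) m k) \<longlonglongrightarrow> 0)" (is "?L \<longleftrightarrow> ?R")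
  proof
    assume L: ?L
    show ?R
    proof (intro allI impI)
      fix c k m assume "\<beta> < k" "\<beta> < m"
      then show "(\<lambda>j. perm_matrix (h j c) m k) \<longlonglongrightarrow> 0"
        using L[rule_format, of m k c] by auto
    qed
  next
    assume R: ?R
    show ?L
    proof (intro allI impI)
      fix c m k :: nat and c' assume "1 \<le> m" "1 \<le> k"
      then show "(\<lambda>j. perm_matrix (h j c') m k) \<longlonglongrightarrow> (if m = k \<and> k \<le> \<beta> then 1 else 0)"
        using R[rule_format, of k m c'] small[of m k c'] by (cases "m \<le> \<beta> \<or> k \<le> \<beta>") auto
    qed
  qed
  with True lim0 show ?thesis by (simp add: weak_zero_def)
qed (auto simp: weak_zero_def)

lemma double_coset_iff:
  "x \<in> double_coset \<alpha> \<beta> g \<longleftrightarrow>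
     (\<exists>\<sigma>\<in>S_inf \<alpha>. \<exists>\<tau>\<in>S_inf \<beta>. x = (\<lambda>c. \<sigma> \<circ> g c \<circ> \<tau>))"
  by (auto simp: double_coset_def r_coset_def set_mult_def K_def GG_def)

lemma self_in_double_coset: "g \<in> double_coset \<alpha> \<beta> g"
  unfolding double_coset_iff by (rule bexI[OF _ S_inf_id], rule bexI[OF _ S_inf_id]) simp

lemma K_subset: "(\<lambda>c. \<sigma>) \<in> carrier GG" if "\<sigma> \<in> S_inf \<alpha>"
  using that by (auto simp: carrier_GG_iff S_inf_def)

lemma double_coset_carrier: "g \<in> carrier GG \<Longrightarrow> double_coset \<alpha> \<beta> g \<subseteq> carrier GG"
  using monoid.m_closed[OF group.is_monoid[OF group_GG]] K_subset
  unfolding double_coset_def r_coset_def set_mult_def K_def by blast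

lemma double_coset_eqI:
  assumes "x \<in> double_coset \<alpha> \<beta> g"
  shows "double_coset \<alpha> \<beta> x = double_coset \<alpha> \<beta> g"
proof -
  obtain \<sigma> \<tau> where st: "\<sigma> \<in> S_inf \<alpha>" "\<tau> \<in> S_inf \<beta>" "x = (\<lambda>c. \<sigma> \<circ> g c \<circ> \<tau>)"
    using assms by (auto simp: double_coset_iff)
  have *: "double_coset \<alpha> \<beta> (\<lambda>c. \<sigma> \<circ> g c \<circ> \<tau>) \<subseteq> double_coset \<alpha> \<beta> g"
    if "\<sigma> \<in> S_inf \<alpha>" "\<tau> \<in> S_inf \<beta>" for \<sigma> \<tau> g
  proof
    fix y assume "y \<in> double_coset \<alpha> \<beta> (\<lambda>c. \<sigma> \<circ> g c \<circ> \<tau>)"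
    then obtain u v where "u \<in> S_inf \<alpha>" "v \<in> S_inf \<beta>" "y = (\<lambda>c. u \<circ> (\<sigma> \<circ> g c \<circ> \<tau>) \<circ> v)"
      by (auto simp: double_coset_iff)
    then show "y \<in> double_coset \<alpha> \<beta> g"
      unfolding double_coset_iff using that
      by (intro bexI[of _ "u \<circ> \<sigma>"] bexI[of _ "\<tau> \<circ> v"] S_inf_comp) (auto simp: comp_assoc)
  qed
  have "g = (\<lambda>c. inv_into UNIV \<sigma> \<circ> x c \<circ> inv_into UNIV \<tau>)"
    using bij_S_inf[OF st(1)] bij_S_inf[OF st(2)] st(3)
    by (auto simp: fun_eq_iff bij_is_inj bij_is_surj surj_f_inv_f)
  then show ?thesis
    using * [OF st(1,2), of g] * [OF S_inf_inv[OF st(1)] S_inf_inv[OF st(2)], of x] st(3) by auto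
qed

lemma board_iso_refl: "board_iso \<alpha> \<beta> X X"
  unfolding board_iso_def by (rule exI[of _ id], rule exI[of _ id]) auto

lemma board_iso_trans:
  assumes "board_iso \<alpha> \<beta> X Y" "board_iso \<alpha> \<beta> Y Z"
  shows "board_iso \<alpha> \<beta> X Z"
proof -
  obtain f g where fg: "bij_betw f (black X) (black Y)" "bij_betw g (white X) (white Y)"
     "\<forall>c. \<forall>b\<in>black X. glue Y c (f b) = g (glue X c b)"
     "\<forall>j\<in>{1..\<beta>}. f (black_label X j) = black_label Y j"
     "\<forall>j\<in>{1..\<alpha>}. g (white_label X j) = white_label Y j"
    using assms(1) unfolding board_iso_def by blast
  obtain f' g' where fg': "bij_betw f' (black Y) (black Z)" "bij_betw g' (white Y) (white Z)"
     "\<forall>c. \<forall>b\<in>black Y. glue Z c (f' b) = g' (glue Y c b)"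
     "\<forall>j\<in>{1..\<beta>}. f' (black_label Y j) = black_label Z j"
     "\<forall>j\<in>{1..\<alpha>}. g' (white_label Y j) = white_label Z j"
    using assms(2) unfolding board_iso_def by blast
  show ?thesis unfolding board_iso_def
    using fg fg' by (intro exI[of _ "f' \<circ> f"] exI[of _ "g' \<circ> g"])
      (auto intro: bij_betw_trans simp: bij_betw_apply)
qed

lemma board_iso_sym:
  assumes "is_board \<alpha> \<beta> X" "board_iso \<alpha> \<beta> X Y"
  shows "board_iso \<alpha> \<beta> Y X"
proof -
  obtain f g where fg: "bij_betw f (black X) (black Y)" "bij_betw g (white X) (white Y)"
     "\<forall>c. \<forall>b\<in>black X. glue Y c (f b) = g (glue X c b)"
     "\<forall>j\<in>{1..\<beta>}. f (black_label X j) = black_label Y j"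
     "\<forall>j\<in>{1..\<alpha>}. g (white_label X j) = white_label Y j"
    using assms(2) unfolding board_iso_def by blast
  let ?f = "inv_into (black X) f" and ?g = "inv_into (white X) g"
  have X: "glue X c b \<in> white X" if "b \<in> black X" for c b
    using assms(1) that by (auto simp: is_board_def bij_betw_def)
  have "glue X c (?f b) = ?g (glue Y c b)" if "b \<in> black Y" for c b
  proof -
    have "f (?f b) = b" "?f b \<in> black X"
      using fg(1) that by (auto simp: bij_betw_def f_inv_into_f inv_into_into)
    then show ?thesis using fg(2,3) X by (metis bij_betw_inv_into_left)
  qed
  moreover have "?f (black_label Y j) = black_label X j" if "j \<in> {1..\<beta>}" for j
    using assms(1) fg(1,4) that unfolding is_board_def
    by (metis bij_betw_inv_into_left image_subset_iff)
  moreover have "?g (white_label Y j) = white_label X j" if "j \<in> {1..\<alpha>}" for j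
    using assms(1) fg(2,5) that unfolding is_board_def
    by (metis bij_betw_inv_into_left image_subset_iff)
  ultimately show ?thesis unfolding board_iso_def
    using bij_betw_inv_into[OF fg(1)] bij_betw_inv_into[OF fg(2)] by blast
qed

lemma board_class_eqI:
  fixes X :: "('b1, 'w1) board" and Y :: "('b2, 'w2) board"
  assumes "is_board \<alpha> \<beta> X" "board_iso \<alpha> \<beta> X Y"
  shows "board_class \<alpha> \<beta> X = board_class \<alpha> \<beta> Y"
proof (intro equalityI subsetI)
  fix Z assume "Z \<in> board_class \<alpha> \<beta> X"
  then show "Z \<in> board_class \<alpha> \<beta> Y"
    using board_iso_trans[OF board_iso_sym[OF assms], of Z] by (simp add: board_class_def)
next
  fix Z assume "Z \<in> board_class \<alpha> \<beta> Y"
  then show "Z \<in> board_class \<alpha> \<beta> X"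
    using board_iso_trans[OF assms(2), of Z] by (simp add: board_class_def)
qed

lemma boards_eq: "boards \<alpha> \<beta> = board_class \<alpha> \<beta> ` {X :: (nat, nat) board. is_board \<alpha> \<beta> X}"
proof -
  have "{(X, Y). is_board \<alpha> \<beta> X \<and> is_board \<alpha> \<beta> Y \<and> board_iso \<alpha> \<beta> X Y} `` {X} = board_class \<alpha> \<beta> X"
    if "is_board \<alpha> \<beta> X" for X :: "(nat, nat) board"
    using that by (auto simp: board_class_def)
  then have "boards \<alpha> \<beta> = (\<Union>X\<in>{X :: (nat, nat) board. is_board \<alpha> \<beta> X}. {board_class \<alpha> \<beta> X})"
    unfolding boards_def quotient_def by simp
  then show ?thesis by blast
qed

lemma empty_cheburek_full:
  "empty_cheburek \<alpha> \<beta> \<lparr>black = {1..}, white = {1..}, glue = g, black_label = id, white_label = id\<rparr> i w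
     \<longleftrightarrow> i > \<beta> \<and> w > \<alpha> \<and> (\<forall>c. g c i = w)"
  by (auto simp: empty_cheburek_def)

lemma black_board_of:
  "black (board_of \<alpha> \<beta> g) = {i. i \<ge> 1 \<and> \<not> (i > \<beta> \<and> (\<exists>w>\<alpha>. \<forall>c. g c i = w))}"
  unfolding board_of_def discard_def empty_cheburek_full by auto

lemma white_board_of:
  assumes "\<And>c. g c permutes {1..}"
  shows "white (board_of \<alpha> \<beta> g) = g c ` black (board_of \<alpha> \<beta> g)"
proof -
  have "w \<in> white (board_of \<alpha> \<beta> g) \<longleftrightarrow> w \<in> g c ` black (board_of \<alpha> \<beta> g)" for w
  proof -
    obtain i where i: "w = g c i" using permutes_surj[OF assms] by (metis surjD)
    have inj: "g d j = g d k \<longleftrightarrow> j = k" for d j k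
      using permutes_inj[OF assms] by (metis injD)
    have pos: "g c i \<ge> 1 \<longleftrightarrow> i \<ge> 1"
      using permutes_in_image[OF assms, of c i] by auto
    have white: "white (board_of \<alpha> \<beta> g) =
        {w. w \<ge> 1 \<and> \<not> (\<exists>i>\<beta>. w > \<alpha> \<and> (\<forall>c. g c i = w))}"
      unfolding board_of_def discard_def empty_cheburek_full by auto
    have eq: "(\<exists>k>\<beta>. g c i > \<alpha> \<and> (\<forall>d. g d k = g c i)) \<longleftrightarrow>
        i > \<beta> \<and> (\<exists>w>\<alpha>. \<forall>d. g d i = w)"
    proof
      assume "\<exists>k>\<beta>. g c i > \<alpha> \<and> (\<forall>d. g d k = g c i)"
      then obtain k where k: "k > \<beta>" "g c i > \<alpha>" "\<forall>d. g d k = g c i" by blast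
      then have "k = i" using inj[of c k i] by simp
      with k show "i > \<beta> \<and> (\<exists>w>\<alpha>. \<forall>d. g d i = w)" by auto
    qed auto
    have "w \<in> g c ` black (board_of \<alpha> \<beta> g) \<longleftrightarrow> i \<in> black (board_of \<alpha> \<beta> g)"
      using inj i by auto
    moreover have "w \<in> white (board_of \<alpha> \<beta> g) \<longleftrightarrow> i \<in> black (board_of \<alpha> \<beta> g)"
      unfolding white i black_board_of mem_Collect_eq pos eq ..
    ultimately show ?thesis by simp
  qed
  then show ?thesis by blast
qed

lemma board_of_sel:
  "glue (board_of \<alpha> \<beta> g) = g" "black_label (board_of \<alpha> \<beta> g) = id"
  "white_label (board_of \<alpha> \<beta> g) = id"
  by (auto simp: board_of_def discard_def)

lemma bij_betw_glue_board_of: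
  assumes "\<And>c. g c permutes {1..}"
  shows "bij_betw (g c) (black (board_of \<alpha> \<beta> g)) (white (board_of \<alpha> \<beta> g))"
  using white_board_of[OF assms, where c = c] permutes_inj_on[OF assms]
  by (simp add: bij_betw_def)

lemma is_board_board_of:
  assumes g: "g \<in> carrier GG"
  shows "is_board \<alpha> \<beta> (board_of \<alpha> \<beta> g)"
proof -
  have perm: "g c permutes {1..}" and fin: "finite {i. g c i \<noteq> g d i}" for c d
    using g by (auto simp: carrier_GG_iff)
  let ?X = "board_of \<alpha> \<beta> g"
  have "black ?X \<subseteq> {1..\<beta>} \<union> g Red -` {..\<alpha>} \<union> (\<Union>c\<in>{Red, Yellow, Blue}. {i. g c i \<noteq> g Red i})"
  proof
    fix i assume i: "i \<in> black ?X"
    show "i \<in> {1..\<beta>} \<union> g Red -` {..\<alpha>} \<union> (\<Union>c\<in>{Red, Yellow, Blue}. {i. g c i \<noteq> g Red i})"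
    proof (cases "i \<le> \<beta> \<or> g Red i \<le> \<alpha>")
      case True
      moreover have "i \<ge> 1" using i by (simp add: black_board_of)
      ultimately show ?thesis by auto
    next
      case False
      then have "i > \<beta>" "g Red i > \<alpha>" by auto
      moreover have "\<not> (i > \<beta> \<and> (\<exists>w>\<alpha>. \<forall>c. g c i = w))"
        using i unfolding black_board_of mem_Collect_eq by (rule conjunct2)
      ultimately have "\<not> (\<forall>c. g c i = g Red i)" by blast
      then obtain c where "g c i \<noteq> g Red i" by blast
      moreover have "c \<in> {Red, Yellow, Blue}" by (cases c) auto
      ultimately show ?thesis by blast
    qed
  qed
  moreover have "finite (g Red -` {..\<alpha>})"
    using perm by (intro finite_vimageI) (auto intro: permutes_inj)
  ultimately have finb: "finite (black ?X)"
    using fin by (elim finite_subset) auto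
  then have finw: "finite (white ?X)" using white_board_of[of g \<alpha> \<beta> Red] perm by simp
  have "j \<in> white ?X" if "j \<in> {1..\<alpha>}" for j
    using that unfolding board_of_def discard_def empty_cheburek_full by auto
  moreover have "j \<in> black ?X" if "j \<in> {1..\<beta>}" for j
    using that by (auto simp: black_board_of)
  moreover have "\<not> empty_cheburek \<alpha> \<beta> ?X b w" for b w
  proof
    assume "empty_cheburek \<alpha> \<beta> ?X b w"
    then have b: "b \<in> black ?X" and e: "b \<notin> {1..\<beta>}" "w \<notin> {1..\<alpha>}" "\<And>c. g c b = w"
      by (auto simp: empty_cheburek_def board_of_sel)
    then have "b \<ge> 1" by (auto simp: black_board_of)
    moreover have "w \<ge> 1"
      using \<open>b \<ge> 1\<close> e(3)[of Red] permutes_in_image[OF perm, of Red b] by auto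
    ultimately have "b > \<beta>" "w > \<alpha>" using e(1,2) by auto
    then show False using b e(3) unfolding black_board_of by blast
  qed
  ultimately show ?thesis
    using finb finw bij_betw_glue_board_of[OF perm]
    by (auto simp: is_board_def board_of_sel)
qed

lemma board_iso_double_coset:
  assumes g: "g \<in> carrier GG" and x: "x \<in> double_coset \<alpha> \<beta> g"
  shows "board_iso \<alpha> \<beta> (board_of \<alpha> \<beta> g) (board_of \<alpha> \<beta> x)"
proof -
  obtain \<sigma> \<tau> where st: "\<sigma> \<in> S_inf \<alpha>" "\<tau> \<in> S_inf \<beta>" and x_eq: "x = (\<lambda>c. \<sigma> \<circ> g c \<circ> \<tau>)"
    using x by (auto simp: double_coset_iff)
  have perm: "g c permutes {1..}" for c
    using g by (auto simp: carrier_GG_iff)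
  have permx: "x c permutes {1..}" for c
    using x double_coset_carrier[OF g] carrier_GG_iff by blast
  let ?t = "inv_into UNIV \<tau>"
  have t: "?t \<in> S_inf \<beta>" using st(2) by (rule S_inf_inv)
  have xt: "x c (?t i) = \<sigma> (g c i)" for c i
    unfolding x_eq using bij_S_inf[OF st(2)] by (simp add: bij_is_surj surj_f_inv_f)
  have gt: "\<rho> i > \<kappa> \<longleftrightarrow> i > \<kappa>" and ge: "\<rho> i \<ge> 1 \<longleftrightarrow> i \<ge> 1" if "\<rho> \<in> S_inf \<kappa>" for \<rho> \<kappa> i
  proof -
    have p: "\<rho> permutes {1..}" and f: "\<And>i. i \<in> {1..\<kappa>} \<Longrightarrow> \<rho> i = i"
      using that by (auto simp: S_inf_def)
    show ge: "\<rho> i \<ge> 1 \<longleftrightarrow> i \<ge> 1" using permutes_in_image[OF p, of i] by auto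
    have inj: "\<rho> k = \<rho> l \<longleftrightarrow> k = l" for k l using permutes_inj[OF p] by (metis injD)
    show "\<rho> i > \<kappa> \<longleftrightarrow> i > \<kappa>"
    proof (cases "i \<ge> 1")
      case True
      have "\<rho> i \<le> \<kappa> \<longleftrightarrow> i \<le> \<kappa>"
        using f[of i] f[of "\<rho> i"] inj[of "\<rho> i" i] True ge by auto
      then show ?thesis by auto
    next
      case False
      then show ?thesis using ge by auto
    qed
  qed
  have s_inj: "\<sigma> k = \<sigma> l \<longleftrightarrow> k = l" for k l
    using bij_S_inf[OF st(1)] by (metis bij_pointE)
  have mem: "?t i \<in> black (board_of \<alpha> \<beta> x) \<longleftrightarrow> i \<in> black (board_of \<alpha> \<beta> g)" for i
  proof -
    have "(\<exists>w>\<alpha>. \<forall>c. \<sigma> (g c i) = w) \<longleftrightarrow> (\<exists>w>\<alpha>. \<forall>c. g c i = w)"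
    proof
      assume "\<exists>w>\<alpha>. \<forall>c. \<sigma> (g c i) = w"
      then have "\<sigma> (g Red i) > \<alpha>" "\<forall>c. \<sigma> (g c i) = \<sigma> (g Red i)" by auto
      then show "\<exists>w>\<alpha>. \<forall>c. g c i = w" using gt[OF st(1)] s_inj by auto
    next
      assume "\<exists>w>\<alpha>. \<forall>c. g c i = w"
      then show "\<exists>w>\<alpha>. \<forall>c. \<sigma> (g c i) = w" using gt[OF st(1)] by auto
    qed
    then show ?thesis unfolding black_board_of mem_Collect_eq xt gt[OF t] ge[OF t] by (rule arg_cong)
  qed
  have black: "black (board_of \<alpha> \<beta> x) = ?t ` black (board_of \<alpha> \<beta> g)"
  proof (intro equalityI subsetI)
    fix k assume k: "k \<in> black (board_of \<alpha> \<beta> x)"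
    obtain i where "k = ?t i" using bij_S_inf[OF t] by (metis bij_pointE)
    with k mem show "k \<in> ?t ` black (board_of \<alpha> \<beta> g)" by blast
  qed (use mem in auto)
  have white: "white (board_of \<alpha> \<beta> x) = \<sigma> ` white (board_of \<alpha> \<beta> g)"
    unfolding white_board_of[of x \<alpha> \<beta> Red, OF permx] white_board_of[of g \<alpha> \<beta> Red, OF perm]
      black image_image xt ..
  show ?thesis
    unfolding board_iso_def
  proof (rule exI[of _ ?t], rule exI[of _ \<sigma>], intro conjI)
    show "bij_betw ?t (black (board_of \<alpha> \<beta> g)) (black (board_of \<alpha> \<beta> x))"
      using bij_S_inf[OF t] black by (metis bij_betw_imageI bij_is_inj inj_on_subset subset_UNIV)
    show "bij_betw \<sigma> (white (board_of \<alpha> \<beta> g)) (white (board_of \<alpha> \<beta> x))"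
      using bij_S_inf[OF st(1)] white by (metis bij_betw_imageI bij_is_inj inj_on_subset subset_UNIV)
  qed (use st(1) t xt in \<open>auto simp: board_of_sel S_inf_def\<close>)
qed

lemma coset_board_double_coset:
  assumes "g \<in> carrier GG"
  shows "coset_board \<alpha> \<beta> (double_coset \<alpha> \<beta> g) = board_class \<alpha> \<beta> (board_of \<alpha> \<beta> g)"
proof -
  have "board_class \<alpha> \<beta> (board_of \<alpha> \<beta> x) = board_class \<alpha> \<beta> (board_of \<alpha> \<beta> g)"
    if "x \<in> double_coset \<alpha> \<beta> g" for x
    using board_class_eqI[OF is_board_board_of board_iso_double_coset] assms that by metis
  then show ?thesis
    using self_in_double_coset[of g \<alpha> \<beta>] unfolding coset_board_def by blast
qed

lemma double_coset_eq_if_board_iso: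
  assumes g: "g \<in> carrier GG" and g': "g' \<in> carrier GG"
    and iso: "board_iso \<alpha> \<beta> (board_of \<alpha> \<beta> g) (board_of \<alpha> \<beta> g')"
  shows "double_coset \<alpha> \<beta> g' = double_coset \<alpha> \<beta> g"
proof -
  let ?X = "board_of \<alpha> \<beta> g" and ?Y = "board_of \<alpha> \<beta> g'"
  obtain u v where u: "bij_betw u (black ?X) (black ?Y)" and v: "bij_betw v (white ?X) (white ?Y)"
    and uv: "\<And>c b. b \<in> black ?X \<Longrightarrow> g' c (u b) = v (g c b)"
    and lu: "\<And>j. j \<in> {1..\<beta>} \<Longrightarrow> u j = j" and lv: "\<And>j. j \<in> {1..\<alpha>} \<Longrightarrow> v j = j"
    using iso by (auto simp: board_iso_def board_of_sel)
  have perm: "g c permutes {1..}" and perm': "g' c permutes {1..}" for c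
    using g g' by (auto simp: carrier_GG_iff)
  have bX: "is_board \<alpha> \<beta> ?X" and bY: "is_board \<alpha> \<beta> ?Y"
    using g g' by (auto intro: is_board_board_of)
  have infinite: "infinite ({1..} - black ?X)" "infinite ({1..} - black ?Y)"
    using bX bY infinite_Ici[of "1::nat"] by (auto simp: is_board_def)
  obtain r where r: "bij_betw r ({1..} - black ?X) ({1..} - black ?Y)"
  proof -
    have "bij_betw (from_nat_into S) UNIV S" if "infinite S" for S :: "nat set"
      using that by (simp add: bij_betw_from_nat_into)
    then show ?thesis using that infinite by (meson bij_betw_inv_into bij_betw_trans)
  qed
  define \<tau> where "\<tau> i = (if i \<in> black ?X then u i else if i \<ge> 1 then r i else i)" for i
  have sub: "black ?X \<subseteq> {1..}" "black ?Y \<subseteq> {1..}" by (auto simp: black_board_of)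
  have "bij_betw \<tau> (black ?X) (black ?Y)"
    using u by (subst bij_betw_cong[of _ _ u]) (auto simp: \<tau>_def)
  moreover have "bij_betw \<tau> ({1..} - black ?X) ({1..} - black ?Y)"
    using r by (subst bij_betw_cong[of _ _ r]) (auto simp: \<tau>_def)
  ultimately have "bij_betw \<tau> (black ?X \<union> ({1..} - black ?X)) (black ?Y \<union> ({1..} - black ?Y))"
    by (rule bij_betw_combine) auto
  then have bij: "bij_betw \<tau> {1..} {1..}" using sub by (simp add: Un_absorb1)
  have \<tau>: "\<tau> permutes {1..}"
    using bij sub by (intro bij_imp_permutes) (auto simp: \<tau>_def)
  moreover have "\<tau> j = j" if "j \<in> {1..\<beta>}" for j
    using that lu by (auto simp: \<tau>_def black_board_of)
  ultimately have \<tau>S: "\<tau> \<in> S_inf \<beta>" by (auto simp: S_inf_def)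
  define \<sigma> where "\<sigma> = g' Red \<circ> \<tau> \<circ> inv_into UNIV (g Red)"
  have \<sigma>g: "\<sigma> (g c i) = g' c (\<tau> i)" for c i
  proof -
    have *: "\<sigma> (g Red i) = g' Red (\<tau> i)" for i
      using permutes_inverses(2)[OF perm] by (simp add: \<sigma>_def)
    consider "i \<in> black ?X" | "i = 0" | "i \<ge> 1" "i \<notin> black ?X" by fastforce
    then show ?thesis
    proof cases
      case 1
      have "g c i \<in> g Red ` black ?X"
        using 1 white_board_of[of g \<alpha> \<beta> c] white_board_of[of g \<alpha> \<beta> Red] perm by auto
      then obtain k where k: "k \<in> black ?X" "g c i = g Red k" by auto
      have "\<sigma> (g c i) = g' Red (u k)" using k * by (simp add: \<tau>_def)
      also have "\<dots> = v (g c i)" using uv k by simp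
      finally show ?thesis using uv 1 by (simp add: \<tau>_def)
    next
      case 2
      have "g c 0 = 0" "g' c 0 = 0" "\<tau> 0 = 0" "g Red 0 = 0" "g' Red 0 = 0" for c
        using permutes_not_in[OF perm] permutes_not_in[OF perm'] permutes_not_in[OF \<tau>] by simp_all
      then show ?thesis using 2 * by metis
    next
      case 3
      have "\<tau> i \<notin> black ?Y" "\<tau> i \<ge> 1"
        using 3 bij_betwE[OF r] by (auto simp: \<tau>_def)
      then have "g' c (\<tau> i) = g' Red (\<tau> i)" by (auto simp: black_board_of)
      moreover have "g c i = g Red i" using 3 by (auto simp: black_board_of)
      ultimately show ?thesis using * by simp
    qed
  qed
  have "\<sigma> permutes {1..}"
    unfolding \<sigma>_def by (intro permutes_compose permutes_inv perm perm' \<tau>)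
  moreover have "\<sigma> j = j" if "j \<in> {1..\<alpha>}" for j
  proof -
    have "j \<in> white ?X" using bX that by (auto simp: is_board_def board_of_sel)
    then obtain k where k: "k \<in> black ?X" "j = g Red k"
      using white_board_of[of g \<alpha> \<beta> Red] perm by auto
    then have "\<sigma> j = g' Red (u k)" using \<sigma>g by (simp add: \<tau>_def)
    also have "\<dots> = v j" using uv k by simp
    finally show ?thesis using lv that by simp
  qed
  ultimately have \<sigma>S: "\<sigma> \<in> S_inf \<alpha>" by (auto simp: S_inf_def)
  have "g' = (\<lambda>c. \<sigma> \<circ> g c \<circ> inv_into UNIV \<tau>)"
    using \<sigma>g permutes_inverses(1)[OF \<tau>] by (auto simp: fun_eq_iff)
  then have "g' \<in> double_coset \<alpha> \<beta> g"
    unfolding double_coset_iff using \<sigma>S S_inf_inv[OF \<tau>S] by blast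
  then show ?thesis by (rule double_coset_eqI)
qed

lemma ex_labelled_enumeration:
  assumes "finite B" "inj_on l {1..\<beta>}" "l ` {1..\<beta>} \<subseteq> B"
  obtains e where "bij_betw e {1..card B} B" "\<And>i. i \<in> {1..\<beta>} \<Longrightarrow> e i = l i" "\<beta> \<le> card B"
proof -
  have card: "card (l ` {1..\<beta>}) = \<beta>" using assms(2) by (simp add: card_image)
  then have le: "\<beta> \<le> card B" using card_mono[OF assms(1,3)] by simp
  have "card {\<beta><..card B} = card (B - l ` {1..\<beta>})"
    using card assms by (simp add: card_Diff_subset finite_subset)
  then obtain e' where e': "bij_betw e' {\<beta><..card B} (B - l ` {1..\<beta>})"
    using assms(1) finite_same_card_bij[of "{\<beta><..card B}" "B - l ` {1..\<beta>}"] by auto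
  define e where "e i = (if i \<le> \<beta> then l i else e' i)" for i
  have "bij_betw e {1..\<beta>} (l ` {1..\<beta>})"
    using assms(2) by (subst bij_betw_cong[of _ _ l]) (auto simp: e_def bij_betw_def)
  moreover have "bij_betw e {\<beta><..card B} (B - l ` {1..\<beta>})"
    using e' by (subst bij_betw_cong[of _ _ e']) (auto simp: e_def)
  ultimately have "bij_betw e ({1..\<beta>} \<union> {\<beta><..card B}) (l ` {1..\<beta>} \<union> (B - l ` {1..\<beta>}))"
    by (rule bij_betw_combine) auto
  moreover have "{1..\<beta>} \<union> {\<beta><..card B} = {1..card B}" using le by auto
  moreover have "l ` {1..\<beta>} \<union> (B - l ` {1..\<beta>}) = B" using assms(3) by auto
  ultimately have "bij_betw e {1..card B} B" by simp
  then show thesis using that le by (simp add: e_def)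
qed

lemma ex_triple_of_board:
  fixes X :: "('b, 'w) board"
  assumes X: "is_board \<alpha> \<beta> X"
  obtains g where "g \<in> carrier GG" "board_iso \<alpha> \<beta> (board_of \<alpha> \<beta> g) X"
proof -
  define n where "n = card (black X)"
  have glue: "bij_betw (glue X c) (black X) (white X)" for c using X by (simp add: is_board_def)
  have n: "card (white X) = n" using bij_betw_same_card[OF glue] n_def by simp
  obtain e where e: "bij_betw e {1..n} (black X)"
      "\<And>i. i \<in> {1..\<beta>} \<Longrightarrow> e i = black_label X i" "\<beta> \<le> n"
    using X ex_labelled_enumeration[of "black X" "black_label X" \<beta>]
    unfolding is_board_def n_def by metis
  obtain f where f: "bij_betw f {1..n} (white X)"
      "\<And>i. i \<in> {1..\<alpha>} \<Longrightarrow> f i = white_label X i" "\<alpha> \<le> n"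
    using X ex_labelled_enumeration[of "white X" "white_label X" \<alpha>]
    unfolding is_board_def n[symmetric] by metis
  let ?f = "inv_into {1..n} f"
  define g where "g c i = (if i \<in> {1..n} then ?f (glue X c (e i)) else i)" for c i
  have bij: "bij_betw (g c) {1..n} {1..n}" for c
  proof -
    have "bij_betw (?f \<circ> (glue X c \<circ> e)) {1..n} {1..n}"
      by (intro bij_betw_trans[of _ _ "white X"] bij_betw_trans[of e _ "black X"]
          e(1) glue bij_betw_inv_into f(1))
    then show ?thesis by (subst bij_betw_cong[of _ _ "?f \<circ> (glue X c \<circ> e)"]) (auto simp: g_def)
  qed
  have "g c permutes {1..n}" for c
    using bij by (intro bij_imp_permutes) (auto simp: g_def)
  then have perm: "g c permutes {1..}" for c by (rule permutes_subset) auto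
  moreover have "finite {i. g c i \<noteq> g d i}" for c d
    by (rule finite_subset[of _ "{1..n}"]) (auto simp: g_def)
  ultimately have g: "g \<in> carrier GG" by (simp add: carrier_GG_iff)
  have fg: "f (g c i) = glue X c (e i)" if "i \<in> {1..n}" for c i
    using that bij_betwE[OF e(1)] bij_betwE[OF glue] bij_betw_inv_into_right[OF f(1)]
    by (simp add: g_def)
  have black: "black (board_of \<alpha> \<beta> g) = {1..n}"
  proof (intro equalityI subsetI)
    fix i assume "i \<in> black (board_of \<alpha> \<beta> g)"
    then have i: "i \<ge> 1" "\<not> (i > \<beta> \<and> (\<exists>w>\<alpha>. \<forall>c. g c i = w))"
      by (simp_all only: black_board_of mem_Collect_eq not_False_eq_True)
    have "i \<le> n"
    proof (rule ccontr)
      assume "\<not> i \<le> n"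
      then have "i > \<beta>" "i > \<alpha>" "\<forall>c. g c i = i" using e(3) f(3) by (auto simp: g_def)
      then show False using i(2) by blast
    qed
    with i(1) show "i \<in> {1..n}" by simp
  next
    fix i assume i: "i \<in> {1..n}"
    show "i \<in> black (board_of \<alpha> \<beta> g)"
    proof (rule ccontr)
      assume "i \<notin> black (board_of \<alpha> \<beta> g)"
      then obtain w where w: "i > \<beta>" "w > \<alpha>" "\<And>c. g c i = w"
        using i by (auto simp: black_board_of)
      have wn: "w \<in> {1..n}" using w(3)[of Red] bij_betwE[OF bij] i by auto
      have "e i \<notin> black_label X ` {1..\<beta>}"
      proof
        assume "e i \<in> black_label X ` {1..\<beta>}"
        then obtain j where j: "j \<in> {1..\<beta>}" "e i = e j" using e(2) by auto
        moreover have "j \<in> {1..n}" using j(1) e(3) by auto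
        ultimately have "i = j" using inj_onD[OF bij_betw_imp_inj_on[OF e(1)]] i by blast
        then show False using j(1) w(1) by simp
      qed
      moreover have "f w \<notin> white_label X ` {1..\<alpha>}"
      proof
        assume "f w \<in> white_label X ` {1..\<alpha>}"
        then obtain j where j: "j \<in> {1..\<alpha>}" "f w = f j" using f(2) by auto
        moreover have "j \<in> {1..n}" using j(1) f(3) by auto
        ultimately have "w = j" using inj_onD[OF bij_betw_imp_inj_on[OF f(1)]] wn by blast
        then show False using j(1) w(2) by simp
      qed
      moreover have "e i \<in> black X" using bij_betwE[OF e(1)] i by blast
      moreover have "f w \<in> white X" using bij_betwE[OF f(1)] wn by blast
      moreover have "glue X c (e i) = f w" for c using fg[OF i, of c] unfolding w(3) ..
      ultimately have "empty_cheburek \<alpha> \<beta> X (e i) (f w)"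
        unfolding empty_cheburek_def by blast
      then show False using X by (auto simp: is_board_def)
    qed
  qed
  have white: "white (board_of \<alpha> \<beta> g) = {1..n}"
    using white_board_of[of g \<alpha> \<beta> Red] perm black bij by (simp add: bij_betw_def)
  have "board_iso \<alpha> \<beta> (board_of \<alpha> \<beta> g) X"
    unfolding board_iso_def black white board_of_sel
    using e(1) f(1) by (intro exI[of _ e] exI[of _ f]) (simp add: e(2) f(2) fg)
  then show thesis using that g by blast
qed

theorem bij_betw_coset_board:
  "bij_betw (coset_board \<alpha> \<beta>) (double_cosets \<alpha> \<beta>) (boards \<alpha> \<beta>)"
proof (rule bij_betw_imageI)
  show "inj_on (coset_board \<alpha> \<beta>) (double_cosets \<alpha> \<beta>)"
  proof (rule inj_onI)
    fix A B assume "A \<in> double_cosets \<alpha> \<beta>" "B \<in> double_cosets \<alpha> \<beta>"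
      and eq: "coset_board \<alpha> \<beta> A = coset_board \<alpha> \<beta> B"
    then obtain g h where g: "g \<in> carrier GG" "A = double_coset \<alpha> \<beta> g"
      and h: "h \<in> carrier GG" "B = double_coset \<alpha> \<beta> h"
      by (auto simp: double_cosets_def)
    have "board_of \<alpha> \<beta> h \<in> board_class \<alpha> \<beta> (board_of \<alpha> \<beta> h)"
      using h by (simp add: board_class_def is_board_board_of board_iso_refl)
    moreover have "board_class \<alpha> \<beta> (board_of \<alpha> \<beta> g) = board_class \<alpha> \<beta> (board_of \<alpha> \<beta> h)"
      using eq g h by (simp add: coset_board_double_coset)
    ultimately have "board_iso \<alpha> \<beta> (board_of \<alpha> \<beta> g) (board_of \<alpha> \<beta> h)"
      unfolding board_class_def by blast
    then show "A = B" using g h double_coset_eq_if_board_iso by metis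
  qed
  show "coset_board \<alpha> \<beta> ` double_cosets \<alpha> \<beta> = boards \<alpha> \<beta>"
  proof (intro equalityI subsetI)
    fix C assume "C \<in> coset_board \<alpha> \<beta> ` double_cosets \<alpha> \<beta>"
    then show "C \<in> boards \<alpha> \<beta>"
      by (auto simp: double_cosets_def boards_eq coset_board_double_coset is_board_board_of)
  next
    fix C assume "C \<in> boards \<alpha> \<beta>"
    then obtain X :: "(nat, nat) board" where X: "is_board \<alpha> \<beta> X" "C = board_class \<alpha> \<beta> X"
      by (auto simp: boards_eq)
    obtain g where g: "g \<in> carrier GG" "board_iso \<alpha> \<beta> (board_of \<alpha> \<beta> g) X"
      using ex_triple_of_board[OF X(1)] .
    then have "C = coset_board \<alpha> \<beta> (double_coset \<alpha> \<beta> g)"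
      using X(2) board_class_eqI[OF is_board_board_of[OF g(1)] g(2)]
      by (simp add: coset_board_double_coset)
    then show "C \<in> coset_board \<alpha> \<beta> ` double_cosets \<alpha> \<beta>"
      using g(1) by (auto simp: double_cosets_def)
  qed
qed

end

theory Submission
  imports Defs
begin

text \<open>
  Only finitely many triangles of the infinite surfaces of \<open>p\<close> and \<open>q\<close> lie outside empty
  chebureks, so for large \<open>j\<close> the permutation \<open>h j\<close> sends no unlabeled white triangle of the
  board of \<open>q\<close> to a black triangle of the board of \<open>p\<close>. Then the infinite surface of \<open>p h\<^sub>j q\<close>
  consists of both boards, glued along the labels \<open>1, \<dots>, \<beta>\<close>, and of empty chebureks: an edge of
  one of the boards which is not at a label meets only triangles of an empty cheburek of the
  other surface, and this does not change the gluing.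
\<close>

section \<open>Surfaces before the removal of empty chebureks\<close>

text \<open>Besides boards, this covers the infinite surface of a triple and the raw result of
  gluing two boards, where empty chebureks may still occur.\<close>

definition preboard :: "nat \<Rightarrow> nat \<Rightarrow> ('b, 'w) board \<Rightarrow> bool" where
  "preboard \<alpha> \<beta> X \<longleftrightarrow>
     (\<forall>c. bij_betw (glue X c) (black X) (white X)) \<and>
     inj_on (black_label X) {1..\<beta>} \<and> black_label X ` {1..\<beta>} \<subseteq> black X \<and>
     inj_on (white_label X) {1..\<alpha>} \<and> white_label X ` {1..\<alpha>} \<subseteq> white X"

lemma preboard_if_is_board: "is_board \<alpha> \<beta> X \<Longrightarrow> preboard \<alpha> \<beta> X"
  by (simp add: is_board_def preboard_def)

lemma preboard_glue_mem: "preboard \<alpha> \<beta> X \<Longrightarrow> b \<in> black X \<Longrightarrow> glue X c b \<in> white X"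
  by (auto simp: preboard_def dest: bij_betwE)

lemma preboard_glue_inj:
  "preboard \<alpha> \<beta> X \<Longrightarrow> a \<in> black X \<Longrightarrow> b \<in> black X \<Longrightarrow> glue X c a = glue X c b \<longleftrightarrow> a = b"
  by (metis preboard_def bij_betw_imp_inj_on inj_on_eq_iff)

lemma preboard_glue_surj:
  assumes "preboard \<alpha> \<beta> X" "w \<in> white X"
  obtains b where "b \<in> black X" "glue X c b = w"
  using assms unfolding preboard_def by (metis bij_betw_imp_surj_on imageE)

lemma discard_sel:
  "glue (discard \<alpha> \<beta> X) = glue X" "black_label (discard \<alpha> \<beta> X) = black_label X"
  "white_label (discard \<alpha> \<beta> X) = white_label X"
  "black (discard \<alpha> \<beta> X) = {b \<in> black X. \<nexists>w. empty_cheburek \<alpha> \<beta> X b w}"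
  "white (discard \<alpha> \<beta> X) = {w \<in> white X. \<nexists>b. empty_cheburek \<alpha> \<beta> X b w}"
  by (auto simp: discard_def)

text \<open>The red neighbor is the only possible partner of \<open>b\<close>, so lying in an empty
  cheburek becomes a condition on \<open>b\<close> alone. In this form it can be carried along
  injections.\<close>

lemma ex_empty_cheburek_iff:
  assumes "preboard \<alpha> \<beta> X" "b \<in> black X"
  shows "(\<exists>w. empty_cheburek \<alpha> \<beta> X b w) \<longleftrightarrow>
    (\<forall>c. glue X c b = glue X Red b) \<and> b \<notin> black_label X ` {1..\<beta>} \<and>
    glue X Red b \<notin> white_label X ` {1..\<alpha>}"
  using preboard_glue_mem[OF assms] assms(2) unfolding empty_cheburek_def by metis

text \<open>A white triangle lies in an empty cheburek exactly when its neighbor across any one edge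
  does, so discarding removes whole chebureks. Later only black triangles have to be
  tracked.\<close>

lemma white_discard:
  assumes X: "preboard \<alpha> \<beta> X"
  shows "white (discard \<alpha> \<beta> X) = glue X c ` black (discard \<alpha> \<beta> X)"
proof -
  have "(\<exists>b'. empty_cheburek \<alpha> \<beta> X b' (glue X c b)) \<longleftrightarrow> (\<exists>w. empty_cheburek \<alpha> \<beta> X b w)"
    if "b \<in> black X" for b
    using that preboard_glue_inj[OF X _ that] unfolding empty_cheburek_def by metis
  moreover have "white X = glue X c ` black X"
    using X by (auto simp: preboard_def bij_betw_def)
  ultimately show ?thesis by (auto simp: discard_sel)
qed

lemma bij_betw_glue_discard:
  assumes X: "preboard \<alpha> \<beta> X"
  shows "bij_betw (glue X c) (black (discard \<alpha> \<beta> X)) (white (discard \<alpha> \<beta> X))"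
  unfolding white_discard[OF X, of c]
  using preboard_glue_inj[OF X] by (intro bij_betw_imageI inj_onI) (auto simp: discard_sel)

text \<open>Discarding once is enough: the remaining gluing is a restriction of the old one and
  labels are never lost, so an empty cheburek of the result would already be one of
  \<open>X\<close>.\<close>

lemma is_board_discard:
  assumes X: "preboard \<alpha> \<beta> X" and "finite (black X)"
  shows "is_board \<alpha> \<beta> (discard \<alpha> \<beta> X)"
proof -
  have fin: "finite (black (discard \<alpha> \<beta> X))" using assms(2) by (simp add: discard_sel)
  then have "finite (white (discard \<alpha> \<beta> X))" unfolding white_discard[OF X, of Red] by simp
  moreover have "black_label X ` {1..\<beta>} \<subseteq> black (discard \<alpha> \<beta> X)"
    "white_label X ` {1..\<alpha>} \<subseteq> white (discard \<alpha> \<beta> X)"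
    using X by (auto simp: preboard_def discard_sel empty_cheburek_def)
  moreover have "\<not> empty_cheburek \<alpha> \<beta> (discard \<alpha> \<beta> X) b w" for b w
    unfolding empty_cheburek_def[of _ _ "discard \<alpha> \<beta> X"]
    by (auto simp: discard_sel empty_cheburek_def)
  ultimately show ?thesis
    using fin X bij_betw_glue_discard[OF X] by (simp add: is_board_def preboard_def discard_sel(1-3))
qed

text \<open>Discarding turns an embedding that misses only empty chebureks into an isomorphism.
  Since \<open>f\<close> and \<open>g\<close> are injective and respect gluing and labels, they both
  preserve and reflect empty chebureks; this settles the black triangles, and
  \<open>white_discard\<close> then gives the white ones.\<close>

lemma board_iso_discard:
  assumes X: "preboard \<alpha> \<beta> X" and Y: "preboard \<alpha> \<beta> Y"
    and f: "inj_on f (black X)" "f ` black X \<subseteq> black Y" and g: "inj_on g (white X)"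
    and glue: "\<And>c b. b \<in> black X \<Longrightarrow> glue Y c (f b) = g (glue X c b)"
    and bl: "\<And>j. j \<in> {1..\<beta>} \<Longrightarrow> f (black_label X j) = black_label Y j"
    and wl: "\<And>j. j \<in> {1..\<alpha>} \<Longrightarrow> g (white_label X j) = white_label Y j"
    and rest: "\<And>b. b \<in> black Y \<Longrightarrow> b \<notin> f ` black X \<Longrightarrow> \<exists>w. empty_cheburek \<alpha> \<beta> Y b w"
  shows "board_iso \<alpha> \<beta> (discard \<alpha> \<beta> X) (discard \<alpha> \<beta> Y)"
proof -
  have bl': "f b \<in> black_label Y ` {1..\<beta>} \<longleftrightarrow> b \<in> black_label X ` {1..\<beta>}" if "b \<in> black X" for b
  proof -
    have "black_label Y ` {1..\<beta>} = f ` black_label X ` {1..\<beta>}"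
      using bl by (auto simp: image_image)
    then show ?thesis using X f(1) that by (simp add: preboard_def inj_on_image_mem_iff)
  qed
  have wl': "g w \<in> white_label Y ` {1..\<alpha>} \<longleftrightarrow> w \<in> white_label X ` {1..\<alpha>}" if "w \<in> white X" for w
  proof -
    have "white_label Y ` {1..\<alpha>} = g ` white_label X ` {1..\<alpha>}"
      using wl by (auto simp: image_image)
    then show ?thesis using X g that by (simp add: preboard_def inj_on_image_mem_iff)
  qed
  have "(\<exists>w. empty_cheburek \<alpha> \<beta> Y (f b) w) \<longleftrightarrow> (\<exists>w. empty_cheburek \<alpha> \<beta> X b w)"
    if b: "b \<in> black X" for b
  proof -
    have "f b \<in> black Y" using f(2) b by blast
    then show ?thesis
      unfolding ex_empty_cheburek_iff[OF X b] ex_empty_cheburek_iff[OF Y \<open>f b \<in> black Y\<close>]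
        glue[OF b] bl'[OF b] wl'[OF preboard_glue_mem[OF X b]]
      using inj_on_eq_iff[OF g preboard_glue_mem[OF X b] preboard_glue_mem[OF X b]] by simp
  qed
  then have black: "black (discard \<alpha> \<beta> Y) = f ` black (discard \<alpha> \<beta> X)"
    using rest f(2) unfolding discard_sel by blast
  have white: "white (discard \<alpha> \<beta> Y) = g ` white (discard \<alpha> \<beta> X)"
    unfolding white_discard[OF X, of Red] white_discard[OF Y, of Red] black image_image
    using glue by (intro image_cong) (auto simp: discard_sel)
  show ?thesis
    unfolding board_iso_def
  proof (rule exI[of _ f], rule exI[of _ g], intro conjI)
    show "bij_betw f (black (discard \<alpha> \<beta> X)) (black (discard \<alpha> \<beta> Y))"
      unfolding black by (intro bij_betw_imageI inj_on_subset[OF f(1)]) (auto simp: discard_sel)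
    show "bij_betw g (white (discard \<alpha> \<beta> X)) (white (discard \<alpha> \<beta> Y))"
      unfolding white by (intro bij_betw_imageI inj_on_subset[OF g]) (auto simp: discard_sel)
  qed (use glue bl wl in \<open>auto simp: discard_sel\<close>)
qed

section \<open>Gluing along labels and its compatibility with isomorphisms\<close>

lemma glue_boards_sel:
  "black (glue_boards \<beta> X Y) = Inl ` (black X - black_label X ` {1..\<beta>}) \<union> Inr ` black Y"
  "white (glue_boards \<beta> X Y) = Inl ` white X \<union> Inr ` (white Y - white_label Y ` {1..\<beta>})"
  "black_label (glue_boards \<beta> X Y) = (\<lambda>j. Inr (black_label Y j))"
  "white_label (glue_boards \<beta> X Y) = (\<lambda>j. Inl (white_label X j))"
  "glue (glue_boards \<beta> X Y) c (Inl b) = Inl (glue X c b)"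
  by (auto simp: glue_boards_def)

lemma glue_glue_boards_Inr:
  "glue Y c b \<notin> white_label Y ` {1..\<beta>} \<Longrightarrow>
     glue (glue_boards \<beta> X Y) c (Inr b) = Inr (glue Y c b)"
  "preboard \<beta> \<gamma> Y \<Longrightarrow> j \<in> {1..\<beta>} \<Longrightarrow> glue Y c b = white_label Y j \<Longrightarrow>
     glue (glue_boards \<beta> X Y) c (Inr b) = Inl (glue X c (black_label X j))"
  by (auto simp: glue_boards_def preboard_def)

text \<open>For each color, cutting out the pair with label \<open>j\<close> breaks one edge on each
  side, from the black triangle \<open>j\<close> of \<open>X\<close> and into the white triangle
  \<open>j\<close> of \<open>Y\<close>. The gluing joins the two loose ends, so every white triangle
  that is left still has exactly one black neighbor of that color.\<close>

lemma preboard_glue_boards: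
  assumes X: "preboard \<alpha> \<beta> X" and Y: "preboard \<beta> \<gamma> Y"
  shows "preboard \<alpha> \<gamma> (glue_boards \<beta> X Y)"
proof -
  let ?G = "glue_boards \<beta> X Y"
  have lX: "black_label X j \<in> black X" if "j \<in> {1..\<beta>}" for j
    using X that by (auto simp: preboard_def)
  have lY: "white_label Y j \<in> white Y" if "j \<in> {1..\<beta>}" for j
    using Y that by (auto simp: preboard_def)
  have injX: "black_label X i = black_label X j \<longleftrightarrow> i = j" if "i \<in> {1..\<beta>}" "j \<in> {1..\<beta>}" for i j
    using X that by (meson preboard_def inj_on_eq_iff)
  have "bij_betw (glue ?G c) (black ?G) (white ?G)" for c
  proof (rule bij_betw_imageI)
    show "inj_on (glue ?G c) (black ?G)"
    proof (rule inj_onI)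
      fix s t assume s: "s \<in> black ?G" and t: "t \<in> black ?G" and eq: "glue ?G c s = glue ?G c t"
      \<comment> \<open>A triangle coming from \<open>Y\<close> reaches \<open>X\<close> only
        through a hole \<open>j\<close>, and there it takes the place of the removed black triangle
        \<open>j\<close>. Colliding with \<open>a\<close> would make \<open>a\<close> that removed
        triangle.\<close>
      have *: False if "a \<in> black X" "a \<notin> black_label X ` {1..\<beta>}" "b \<in> black Y"
        "glue ?G c (Inl a) = glue ?G c (Inr b)" for a b
      proof (cases "glue Y c b \<in> white_label Y ` {1..\<beta>}")
        case True
        then obtain j where j: "j \<in> {1..\<beta>}" "glue Y c b = white_label Y j" by blast
        have "glue X c a = glue X c (black_label X j)"
          using that(4) glue_glue_boards_Inr(2)[OF Y j, of X] by (simp add: glue_boards_sel(5))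
        then have "a = black_label X j"
          using preboard_glue_inj[OF X that(1) lX[OF j(1)]] by simp
        then show False using that(2) j(1) by blast
      qed (use that in \<open>simp add: glue_glue_boards_Inr glue_boards_sel\<close>)
      \<comment> \<open>The side on which the common value lies tells whether the edges pass through
        a hole. If they do, injectivity of the gluing and of the labels of \<open>X\<close> shows
        that it is the same hole.\<close>
      have **: "a = b" if ab: "a \<in> black Y" "b \<in> black Y"
        and e: "glue ?G c (Inr a) = glue ?G c (Inr b)" for a b
      proof -
        have "glue Y c a = glue Y c b"
        proof (cases "glue Y c a \<in> white_label Y ` {1..\<beta>}")
          case True
          then obtain i where i: "i \<in> {1..\<beta>}" "glue Y c a = white_label Y i" by blast
          note a = glue_glue_boards_Inr(2)[OF Y i, of X]
          have "glue Y c b \<in> white_label Y ` {1..\<beta>}"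
          proof (rule ccontr)
            assume "glue Y c b \<notin> white_label Y ` {1..\<beta>}"
            from glue_glue_boards_Inr(1)[OF this, of X] a e show False by simp
          qed
          then obtain j where j: "j \<in> {1..\<beta>}" "glue Y c b = white_label Y j" by blast
          have "i = j"
            using a glue_glue_boards_Inr(2)[OF Y j, of X] e i j
              preboard_glue_inj[OF X lX lX] injX by simp
          then show ?thesis using i j by simp
        next
          case False
          note a = glue_glue_boards_Inr(1)[OF False, of X]
          have "glue Y c b \<notin> white_label Y ` {1..\<beta>}"
          proof
            assume "glue Y c b \<in> white_label Y ` {1..\<beta>}"
            then obtain j where "j \<in> {1..\<beta>}" "glue Y c b = white_label Y j" by blast
            from glue_glue_boards_Inr(2)[OF Y this, of X] a e show False by simp
          qed
          from glue_glue_boards_Inr(1)[OF this, of X] a e show ?thesis by simp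
        qed
        then show ?thesis using preboard_glue_inj[OF Y ab] by simp
      qed
      show "s = t"
      proof (cases s; cases t)
        fix a b assume "s = Inl a" "t = Inl b"
        then show ?thesis
          using s t eq preboard_glue_inj[OF X] by (auto simp: glue_boards_sel)
      next
        fix a b assume "s = Inl a" "t = Inr b"
        then show ?thesis using s t eq *[of a b] by (auto simp: glue_boards_sel(1))
      next
        fix a b assume "s = Inr a" "t = Inl b"
        then show ?thesis using s t eq *[of b a] by (auto simp: glue_boards_sel(1))
      next
        fix a b assume "s = Inr a" "t = Inr b"
        then show ?thesis using s t eq **[of a b] by (auto simp: glue_boards_sel(1))
      qed
    qed
    show "glue ?G c ` black ?G = white ?G"
    proof (intro equalityI subsetI)
      fix w assume "w \<in> glue ?G c ` black ?G"
      then obtain t where t: "t \<in> black ?G" "w = glue ?G c t" by blast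
      show "w \<in> white ?G"
      proof (cases t)
        case (Inl a)
        then show ?thesis using t preboard_glue_mem[OF X] by (auto simp: glue_boards_sel)
      next
        case (Inr b)
        then have b: "b \<in> black Y" using t by (auto simp: glue_boards_sel)
        show ?thesis
        proof (cases "glue Y c b \<in> white_label Y ` {1..\<beta>}")
          case True
          then obtain j where j: "j \<in> {1..\<beta>}" "glue Y c b = white_label Y j" by blast
          have "w = Inl (glue X c (black_label X j))"
            using t(2) Inr glue_glue_boards_Inr(2)[OF Y j, of X] by simp
          then show ?thesis
            using preboard_glue_mem[OF X lX[OF j(1)]] by (simp add: glue_boards_sel(2))
        next
          case False
          have "w = Inr (glue Y c b)"
            using t(2) Inr glue_glue_boards_Inr(1)[OF False, of X] by simp
          then show ?thesis
            using False preboard_glue_mem[OF Y b] by (simp add: glue_boards_sel(2))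
        qed
      qed
    next
      fix w assume w: "w \<in> white ?G"
      show "w \<in> glue ?G c ` black ?G"
      proof (cases w)
        case (Inl v)
        then have v: "v \<in> white X" using w by (auto simp: glue_boards_sel)
        obtain a where a: "a \<in> black X" "glue X c a = v" using preboard_glue_surj[OF X v] .
        show ?thesis
        proof (cases "a \<in> black_label X ` {1..\<beta>}")
          case True
          then obtain j where j: "j \<in> {1..\<beta>}" "a = black_label X j" by blast
          \<comment> \<open>The former neighbor of \<open>v\<close> was cut out; its role passes to
            the triangle of \<open>Y\<close> that was adjacent to the white triangle
            \<open>j\<close>.\<close>
          obtain b where b: "b \<in> black Y" "glue Y c b = white_label Y j"
            using preboard_glue_surj[OF Y lY[OF j(1)]] .
          have "w = glue ?G c (Inr b)"
            using glue_glue_boards_Inr(2)[OF Y j(1) b(2), of X] a j Inl by simp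
          moreover have "Inr b \<in> black ?G" using b by (simp add: glue_boards_sel)
          ultimately show ?thesis by blast
        next
          case False
          then have "w = glue ?G c (Inl a)" "Inl a \<in> black ?G"
            using a Inl by (simp_all add: glue_boards_sel)
          then show ?thesis by blast
        qed
      next
        case (Inr v)
        then have v: "v \<in> white Y" "v \<notin> white_label Y ` {1..\<beta>}"
          using w by (auto simp: glue_boards_sel)
        obtain b where b: "b \<in> black Y" "glue Y c b = v" using preboard_glue_surj[OF Y v(1)] .
        then have "w = glue ?G c (Inr b)" "Inr b \<in> black ?G"
          using v Inr glue_glue_boards_Inr(1)[of Y c b \<beta> X] by (simp_all add: glue_boards_sel)
        then show ?thesis by blast
      qed
    qed
  qed
  moreover have "inj_on (black_label Y) {1..\<gamma>}" "inj_on (white_label X) {1..\<alpha>}"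
    using X Y by (simp_all add: preboard_def)
  then have "inj_on (black_label ?G) {1..\<gamma>}" "inj_on (white_label ?G) {1..\<alpha>}"
    unfolding glue_boards_sel(3,4) inj_on_def sum.inject by blast+
  moreover have "black_label ?G ` {1..\<gamma>} \<subseteq> black ?G" "white_label ?G ` {1..\<alpha>} \<subseteq> white ?G"
    using X Y by (auto simp: preboard_def glue_boards_sel(1-4))
  ultimately show ?thesis unfolding preboard_def by blast
qed

lemma is_board_discard_glue_boards:
  assumes "is_board \<alpha> \<beta> X" "is_board \<beta> \<gamma> Y"
  shows "is_board \<alpha> \<gamma> (discard \<alpha> \<gamma> (glue_boards \<beta> X Y))"
proof (rule is_board_discard)
  show "preboard \<alpha> \<gamma> (glue_boards \<beta> X Y)"
    using assms by (intro preboard_glue_boards preboard_if_is_board)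
qed (use assms in \<open>simp add: glue_boards_sel is_board_def\<close>)

text \<open>The product does not depend on representatives: isomorphisms of the factors match the
  holes label by label, so their disjoint sum respects the new gluing. This sum is onto, hence the
  last premise of \<open>board_iso_discard\<close> holds vacuously.\<close>

lemma board_iso_discard_glue_boards_cong:
  assumes X: "is_board \<alpha> \<beta> X" "is_board \<alpha> \<beta> X'" "board_iso \<alpha> \<beta> X X'"
    and Y: "is_board \<beta> \<gamma> Y" "is_board \<beta> \<gamma> Y'" "board_iso \<beta> \<gamma> Y Y'"
  shows "board_iso \<alpha> \<gamma> (discard \<alpha> \<gamma> (glue_boards \<beta> X Y)) (discard \<alpha> \<gamma> (glue_boards \<beta> X' Y'))"
proof -
  note pX = X(1,2)[THEN preboard_if_is_board] and pY = Y(1,2)[THEN preboard_if_is_board]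
  obtain f g where f: "bij_betw f (black X) (black X')" and g: "bij_betw g (white X) (white X')"
    and fg: "\<And>c b. b \<in> black X \<Longrightarrow> glue X' c (f b) = g (glue X c b)"
    and bl: "\<And>j. j \<in> {1..\<beta>} \<Longrightarrow> f (black_label X j) = black_label X' j"
    and wl: "\<And>j. j \<in> {1..\<alpha>} \<Longrightarrow> g (white_label X j) = white_label X' j"
    using X(3) unfolding board_iso_def by blast
  obtain u v where u: "bij_betw u (black Y) (black Y')" and v: "bij_betw v (white Y) (white Y')"
    and uv: "\<And>c b. b \<in> black Y \<Longrightarrow> glue Y' c (u b) = v (glue Y c b)"
    and bl': "\<And>j. j \<in> {1..\<gamma>} \<Longrightarrow> u (black_label Y j) = black_label Y' j"
    and wl': "\<And>j. j \<in> {1..\<beta>} \<Longrightarrow> v (white_label Y j) = white_label Y' j"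
    using Y(3) unfolding board_iso_def by blast
  have lX: "black_label X ` {1..\<beta>} \<subseteq> black X" using X(1) by (simp add: is_board_def)
  have lY: "white_label Y ` {1..\<beta>} \<subseteq> white Y" using Y(1) by (simp add: is_board_def)
  have "f ` black_label X ` {1..\<beta>} = black_label X' ` {1..\<beta>}"
    using bl by (auto simp: image_image)
  then have f': "f ` (black X - black_label X ` {1..\<beta>}) = black X' - black_label X' ` {1..\<beta>}"
    using f lX by (simp add: bij_betw_def inj_on_image_set_diff[of f "black X"])
  have v': "v w \<in> white_label Y' ` {1..\<beta>} \<longleftrightarrow> w \<in> white_label Y ` {1..\<beta>}" if "w \<in> white Y" for w
  proof -
    have "white_label Y' ` {1..\<beta>} = v ` white_label Y ` {1..\<beta>}"
      using wl' by (auto simp: image_image)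
    then show ?thesis using inj_on_image_mem_iff[OF bij_betw_imp_inj_on[OF v] that lY] by simp
  qed
  have inj: "inj_on (map_sum k l) (Inl ` A \<union> Inr ` B)" if "inj_on k A" "inj_on l B"
    for k :: "'x1 \<Rightarrow> 'x2" and l :: "'y1 \<Rightarrow> 'y2" and A B
    using that[THEN inj_on_eq_iff] by (intro inj_onI) (elim UnE imageE; simp)
  have im: "map_sum f u ` black (glue_boards \<beta> X Y) = black (glue_boards \<beta> X' Y')"
    unfolding glue_boards_sel image_Un f'[symmetric] bij_betw_imp_surj_on[OF u, symmetric]
    by (simp add: image_image)
  show ?thesis
  proof (rule board_iso_discard[where f = "map_sum f u" and g = "map_sum g v"])
    show "inj_on (map_sum f u) (black (glue_boards \<beta> X Y))"
      unfolding glue_boards_sel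
      using f u by (intro inj) (auto simp: bij_betw_def intro: inj_on_subset)
    show "inj_on (map_sum g v) (white (glue_boards \<beta> X Y))"
      unfolding glue_boards_sel
      using g v by (intro inj) (auto simp: bij_betw_def intro: inj_on_subset)
    show "glue (glue_boards \<beta> X' Y') c (map_sum f u t) = map_sum g v (glue (glue_boards \<beta> X Y) c t)"
      if t: "t \<in> black (glue_boards \<beta> X Y)" for c t
    proof (cases t)
      case (Inl a)
      then show ?thesis using t fg by (auto simp: glue_boards_sel)
    next
      case (Inr b)
      then have b: "b \<in> black Y" using t by (auto simp: glue_boards_sel)
      show ?thesis
      proof (cases "glue Y c b \<in> white_label Y ` {1..\<beta>}")
        case True
        then obtain j where j: "j \<in> {1..\<beta>}" "glue Y c b = white_label Y j" by blast
        then have "glue Y' c (u b) = white_label Y' j" using uv[OF b] wl' by simp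
        note eq = glue_glue_boards_Inr(2)[OF pY(2) j(1) this, of X']
        have "black_label X j \<in> black X" using lX j(1) by blast
        from fg[OF this, of c] show ?thesis
          using eq glue_glue_boards_Inr(2)[OF pY(1) j, of X] Inr bl[OF j(1)] by simp
      next
        case False
        then have "glue Y' c (u b) \<notin> white_label Y' ` {1..\<beta>}"
          using uv[OF b] v' preboard_glue_mem[OF pY(1) b] by simp
        from glue_glue_boards_Inr(1)[OF this, of X'] glue_glue_boards_Inr(1)[OF False, of X]
        show ?thesis using Inr uv[OF b] by simp
      qed
    qed
  qed (use im pX pY bl' wl in \<open>auto intro!: preboard_glue_boards simp: glue_boards_sel(3,4)\<close>)
qed

section \<open>Comparison with the infinite surface of a product of triples\<close>

definition full_board :: "triple \<Rightarrow> (nat, nat) board" where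
  "full_board g = \<lparr>black = {1..}, white = {1..}, glue = g, black_label = id, white_label = id\<rparr>"

lemma preboard_full_board:
  assumes "\<And>c. g c permutes {1..}"
  shows "preboard \<alpha> \<beta> (full_board g)"
  using permutes_imp_bij[OF assms] by (auto simp: preboard_def full_board_def)

lemma board_of_eq_discard: "board_of \<alpha> \<beta> g = discard \<alpha> \<beta> (full_board g)"
  by (simp add: board_of_def full_board_def)

lemma not_in_black_board_ofE:
  assumes "i \<notin> black (board_of \<alpha> \<beta> g)" "i \<ge> 1"
  obtains w where "i > \<beta>" "w > \<alpha>" "\<And>c. g c i = w"
  using assms unfolding black_board_of by blast

text \<open>The red neighbor of a discarded white triangle is discarded too, hence lies in an empty
  cheburek, and all three colors lead from it to \<open>w\<close>.\<close>

lemma not_in_white_board_ofE: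
  assumes g: "g \<in> carrier GG" and w: "w \<notin> white (board_of \<alpha> \<beta> g)" "w \<ge> 1"
  obtains i where "i \<ge> 1" "i \<notin> black (board_of \<alpha> \<beta> g)" "\<And>c. g c i = w"
proof -
  have perm: "g c permutes {1..}" for c using g by (auto simp: carrier_GG_iff)
  obtain i where i: "g Red i = w" using permutes_surj[OF perm] by (metis surjD)
  then have i1: "i \<ge> 1" using w(2) permutes_in_image[OF perm, of Red i] by simp
  have n: "i \<notin> black (board_of \<alpha> \<beta> g)" using w(1) i white_board_of[of g \<alpha> \<beta> Red, OF perm] by blast
  obtain w' where "\<And>c. g c i = w'" using not_in_black_board_ofE[OF n i1] by blast
  then show thesis using that[OF i1 n] i by metis
qed

lemma inj_on_case_sum:
  assumes "inj_on k A" "inj_on l B" "\<And>a b. a \<in> A \<Longrightarrow> b \<in> B \<Longrightarrow> k a \<noteq> l b"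
  shows "inj_on (case_sum k l) (Inl ` A \<union> Inr ` B)"
  using assms(1,2)[THEN inj_on_eq_iff] assms(3) assms(3)[symmetric]
  by (intro inj_onI) (elim UnE imageE; simp)

text \<open>This is the geometric core, for one fixed permutation \<open>s\<close> in place of
  \<open>h j\<close>. By \<open>sep\<close>, the middle permutation joins unlabeled triangles of
  either board only to empty chebureks of the other surface, while it joins equal labels as the
  gluing does. The glued board therefore embeds into the surface of the product.\<close>

lemma board_iso_glue_boards_if_separated:
  assumes p: "p \<in> carrier GG" and q: "q \<in> carrier GG" and s: "s \<in> S_inf \<beta>"
    and sep: "\<And>w. w \<in> white (board_of \<beta> \<gamma> q) \<Longrightarrow> w > \<beta> \<Longrightarrow> s w \<notin> black (board_of \<alpha> \<beta> p)"
  shows "board_iso \<alpha> \<gamma> (discard \<alpha> \<gamma> (glue_boards \<beta> (board_of \<alpha> \<beta> p) (board_of \<beta> \<gamma> q)))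
     (board_of \<alpha> \<gamma> (\<lambda>c. p c \<circ> s \<circ> q c))"
proof -
  let ?X = "board_of \<alpha> \<beta> p" and ?Y = "board_of \<beta> \<gamma> q"
  let ?G = "glue_boards \<beta> ?X ?Y" and ?g = "\<lambda>c. p c \<circ> s \<circ> q c"
  have pp: "p c permutes {1..}" and pq: "q c permutes {1..}" for c
    using p q by (auto simp: carrier_GG_iff)
  have ps: "s permutes {1..}" using s by (simp add: S_inf_def)
  have s_fix: "s j = j" if "j \<in> {1..\<beta>}" for j using s that by (simp add: S_inf_def)
  have inj: "p c i = p c k \<longleftrightarrow> i = k" "q c i = q c k \<longleftrightarrow> i = k" "s i = s k \<longleftrightarrow> i = k" for c i k
    using permutes_inj[OF pp] permutes_inj[OF pq] permutes_inj[OF ps] by (metis injD)+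
  have ge: "p c i \<ge> 1 \<longleftrightarrow> i \<ge> 1" "q c i \<ge> 1 \<longleftrightarrow> i \<ge> 1" "s i \<ge> 1 \<longleftrightarrow> i \<ge> 1" for c i
    using permutes_in_image[OF pp] permutes_in_image[OF pq] permutes_in_image[OF ps] by auto
  have s_gt: "s w > \<beta>" if "w > \<beta>" for w
    using that s_fix[of "s w"] inj(3)[of "s w" w] ge(3)[of w] by fastforce
  have black_ge: "i \<ge> 1" if "i \<in> black (board_of \<kappa> \<mu> g)" for i \<kappa> \<mu> g
    using that by (simp add: black_board_of)
  have bX: "preboard \<alpha> \<beta> ?X" and bY: "preboard \<beta> \<gamma> ?Y"
    using p q by (auto intro: preboard_if_is_board is_board_board_of)
  have white_ge: "w \<ge> 1" if w: "w \<in> white ?Y" for w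
    using w white_board_of[of q \<beta> \<gamma> Red, OF pq] black_ge ge(2) by auto
  text \<open>
    An unlabeled black triangle \<open>b\<close> of \<open>?X\<close> is carried by the black triangle \<open>i\<close> of the empty
    cheburek of \<open>q\<close> whose white triangle \<open>s\<close> maps to \<open>b\<close>; an unlabeled white triangle \<open>w\<close> of \<open>?Y\<close>
    is carried by the white triangle of the empty cheburek of \<open>p\<close> at \<open>s w\<close>.
  \<close>
  have ex: "\<exists>i\<ge>1. i \<notin> black ?Y \<and> (\<forall>c. s (q c i) = b)" if b: "b \<in> black ?X" "b > \<beta>" for b
  proof -
    obtain w where w: "s w = b" using permutes_surj[OF ps] by (metis surjD)
    have "w \<ge> 1" using w black_ge[OF b(1)] ge(3) by metis
    moreover have "w > \<beta>" using w b(2) s_fix[of w] \<open>w \<ge> 1\<close> by fastforce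
    ultimately have "w \<notin> white ?Y" "w \<ge> 1" using sep w b(1) by auto
    then obtain i where "i \<ge> 1" "i \<notin> black ?Y" "\<And>c. q c i = w"
      using not_in_white_board_ofE[OF q] by blast
    then show ?thesis using w by auto
  qed
  have "\<forall>b. \<exists>i. b \<in> black ?X \<and> b > \<beta> \<longrightarrow> i \<ge> 1 \<and> i \<notin> black ?Y \<and> (\<forall>c. s (q c i) = b)"
    using ex by blast
  then obtain k where k: "\<And>b. b \<in> black ?X \<Longrightarrow> b > \<beta> \<Longrightarrow> k b \<ge> 1 \<and> k b \<notin> black ?Y"
      "\<And>b c. b \<in> black ?X \<Longrightarrow> b > \<beta> \<Longrightarrow> s (q c (k b)) = b"
    by metis
  \<comment> \<open>Separation puts \<open>s w\<close> into an empty cheburek of \<open>p\<close>,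
    so \<open>Red\<close> below is an arbitrary choice of color.\<close>
  have p_const: "p c (s w) = p Red (s w)" if "w \<in> white ?Y" "w > \<beta>" for c w
    using sep[OF that] ge(3)[of w] that(2) by (auto elim: not_in_black_board_ofE)
  \<comment> \<open>In the product \<open>q\<close> acts first and \<open>p\<close> last, so black
    triangles of \<open>?Y\<close> and white triangles of \<open>?X\<close> keep their numbers; only
    the other two kinds must be moved.\<close>
  define f where "f = case_sum k id"
  define g where "g = case_sum id (\<lambda>w. p Red (s w))"
  have gt: "b \<ge> 1 \<and> b \<notin> {1..\<beta>} \<longleftrightarrow> b > \<beta>" for b :: nat by auto
  have blackG: "black ?G = Inl ` {b \<in> black ?X. b > \<beta>} \<union> Inr ` black ?Y"
    using black_ge gt by (auto simp: glue_boards_sel(1) board_of_sel)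
  have whiteG: "white ?G = Inl ` white ?X \<union> Inr ` {w \<in> white ?Y. w > \<beta>}"
    using white_ge gt by (auto simp: glue_boards_sel(2) board_of_sel)
  have "board_iso \<alpha> \<gamma> (discard \<alpha> \<gamma> ?G) (discard \<alpha> \<gamma> (full_board ?g))"
  proof (rule board_iso_discard[where f = f and g = g])
    show "preboard \<alpha> \<gamma> ?G" using bX bY by (rule preboard_glue_boards)
    show "preboard \<alpha> \<gamma> (full_board ?g)"
      by (intro preboard_full_board permutes_compose pp pq ps)
    show "inj_on f (black ?G)"
      unfolding f_def blackG
    proof (rule inj_on_case_sum)
      show "inj_on k {b \<in> black ?X. b > \<beta>}"
        by (rule inj_on_inverseI[where g = "\<lambda>i. s (q Red i)"]) (simp add: k(2))
    qed (use k(1) in auto)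
    show "f ` black ?G \<subseteq> black (full_board ?g)"
      unfolding blackG f_def full_board_def using k(1) black_ge by force
    show "inj_on g (white ?G)"
      unfolding g_def whiteG
    proof (rule inj_on_case_sum)
      \<comment> \<open>As \<open>v\<close> is the red neighbor of a black triangle of
        \<open>?X\<close> and \<open>s w\<close> is not such a triangle, injectivity of
        \<open>p Red\<close> keeps the two values apart.\<close>
      show "id v \<noteq> p Red (s w)" if "v \<in> white ?X" "w \<in> {w \<in> white ?Y. w > \<beta>}" for v w
        using that sep[of w] white_board_of[of p \<alpha> \<beta> Red, OF pp] inj(1) by auto
    qed (auto simp: inj_on_def inj(1,3))
    show "glue (full_board ?g) c (f t) = g (glue ?G c t)" if t: "t \<in> black ?G" for c t
    proof (cases t)
      case (Inl a)
      then show ?thesis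
        using t k(2) by (auto simp: blackG f_def g_def full_board_def glue_boards_sel(5) board_of_sel)
    next
      case (Inr b)
      then have b: "b \<in> black ?Y" using t by (auto simp: blackG)
      show ?thesis
      proof (cases "q c b \<in> {1..\<beta>}")
        case True
        then have "glue ?G c t = Inl (p c (q c b))"
          using Inr glue_glue_boards_Inr(2)[OF bY True, of c b ?X] by (simp add: board_of_sel)
        then show ?thesis using Inr s_fix[OF True] by (simp add: f_def g_def full_board_def)
      next
        case False
        then have G: "glue ?G c t = Inr (q c b)"
          using Inr glue_glue_boards_Inr(1)[of ?Y c b \<beta> ?X] by (simp add: board_of_sel)
        have w: "q c b \<in> white ?Y"
          using preboard_glue_mem[OF bY b] by (simp add: board_of_sel)
        then have "q c b > \<beta>" using False gt white_ge by blast
        from p_const[OF w this, of c] show ?thesis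
          using Inr G by (simp add: f_def g_def full_board_def)
      qed
    qed
    \<comment> \<open>A missed \<open>i\<close> lies in an empty cheburek of \<open>q\<close>, with
      white triangle \<open>w\<close>. If \<open>s w\<close> were in \<open>?X\<close>, then
      \<open>i\<close> would be the carrier \<open>k (s w)\<close>; so \<open>s w\<close> lies in an
      empty cheburek of \<open>p\<close> as well, and the two combine to an empty cheburek of the
      product.\<close>
    show "\<exists>w. empty_cheburek \<alpha> \<gamma> (full_board ?g) i w"
      if i: "i \<in> black (full_board ?g)" and ni: "i \<notin> f ` black ?G" for i
    proof -
      have i1: "i \<ge> 1" using i by (simp add: full_board_def)
      have "f (Inr i) = i" by (simp add: f_def)
      then have "i \<notin> black ?Y" using ni unfolding blackG by (metis UnI2 image_eqI)
      from not_in_black_board_ofE[OF this i1]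
      obtain w where w: "i > \<gamma>" "w > \<beta>" "\<And>c. q c i = w" by blast
      have "s w \<notin> black ?X"
      proof
        assume sw: "s w \<in> black ?X"
        then have "q Red (k (s w)) = w" using k(2)[OF sw s_gt[OF w(2)]] inj(3) by simp
        then have "k (s w) = i" using w(3)[of Red] inj(2) by metis
        then have "f (Inl (s w)) = i" by (simp add: f_def)
        moreover have "Inl (s w) \<in> black ?G" using sw s_gt[OF w(2)] by (simp add: blackG)
        ultimately show False using ni by blast
      qed
      moreover have "s w \<ge> 1" using s_gt[OF w(2)] by simp
      ultimately obtain v where "v > \<alpha>" "\<And>c. p c (s w) = v"
        using not_in_black_board_ofE by blast
      then show ?thesis
        using i1 w unfolding full_board_def empty_cheburek_full by auto
    qed
  qed (auto simp: f_def g_def full_board_def glue_boards_sel(3,4) board_of_sel)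
  then show ?thesis by (simp only: board_of_eq_discard)
qed

section \<open>Products of classes and the limit along a weak zero\<close>

text \<open>The union defining \<open>board_mult\<close> runs over sets that all coincide, so the
  product can be computed from any chosen representatives.\<close>

lemma board_mult_board_class:
  fixes X Y :: "(nat, nat) board"
  assumes X: "is_board \<alpha> \<beta> X" and Y: "is_board \<beta> \<gamma> Y"
  shows "board_mult \<alpha> \<beta> \<gamma> (board_class \<alpha> \<beta> X) (board_class \<beta> \<gamma> Y) =
    board_class \<alpha> \<gamma> (discard \<alpha> \<gamma> (glue_boards \<beta> X Y))"
proof -
  have "board_class \<alpha> \<gamma> (discard \<alpha> \<gamma> (glue_boards \<beta> X' Y')) =
      board_class \<alpha> \<gamma> (discard \<alpha> \<gamma> (glue_boards \<beta> X Y))"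
    if "X' \<in> board_class \<alpha> \<beta> X" "Y' \<in> board_class \<beta> \<gamma> Y" for X' Y'
    using that X Y board_class_eqI[OF is_board_discard_glue_boards[OF X Y]
        board_iso_discard_glue_boards_cong[OF X _ _ Y]]
    by (auto simp: board_class_def)
  moreover have "X \<in> board_class \<alpha> \<beta> X" "Y \<in> board_class \<beta> \<gamma> Y"
    using X Y by (auto simp: board_class_def board_iso_refl)
  ultimately show ?thesis unfolding board_mult_def by blast
qed

text \<open>Each pair is avoided from some index on, and there are only finitely many pairs.\<close>

lemma eventually_weak_zero_separated:
  assumes h: "weak_zero \<beta> h" and "finite M" "finite N"
  shows "\<forall>\<^sub>F j in sequentially. \<forall>k\<in>M. \<forall>m\<in>N. k > \<beta> \<longrightarrow> m > \<beta> \<longrightarrow> h j c k \<noteq> m"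
proof -
  have "\<forall>\<^sub>F j in sequentially. k > \<beta> \<longrightarrow> m > \<beta> \<longrightarrow> h j c k \<noteq> m" for k m
    using h by (cases "k > \<beta> \<and> m > \<beta>") (auto simp: weak_zero_iff)
  then show ?thesis using assms(2,3) by (intro eventually_ball_finite ballI)
qed

theorem theorem2p4:
  fixes \<alpha> \<beta> \<gamma> :: nat
    and A B :: "triple set"
    and p q :: triple
    and h :: "nat \<Rightarrow> triple"
  assumes "A \<in> double_cosets \<alpha> \<beta>"
    and "B \<in> double_cosets \<beta> \<gamma>"
    and "p \<in> A"
    and "q \<in> B"
    and "weak_zero \<beta> h"
  shows "\<forall>\<^sub>F j in sequentially.
           double_coset \<alpha> \<gamma> (p \<otimes>\<^bsub>GG\<^esub> h j \<otimes>\<^bsub>GG\<^esub> q) = coset_mult \<alpha> \<beta> \<gamma> A B"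
proof -
  \<comment> \<open>Every element represents its double coset, so the given \<open>p\<close> and
    \<open>q\<close> can be used to compute the boards.\<close>
  have coset: "g \<in> carrier GG \<and> C = double_coset \<kappa> \<mu> g"
    if "C \<in> double_cosets \<kappa> \<mu>" "g \<in> C" for C g \<kappa> \<mu>
    using that double_coset_eqI double_coset_carrier unfolding double_cosets_def by blast
  note p = coset[OF assms(1,3), THEN conjunct1] and A = coset[OF assms(1,3), THEN conjunct2]
  note q = coset[OF assms(2,4), THEN conjunct1] and B = coset[OF assms(2,4), THEN conjunct2]
  let ?X = "board_of \<alpha> \<beta> p" and ?Y = "board_of \<beta> \<gamma> q"
  have X: "is_board \<alpha> \<beta> ?X" and Y: "is_board \<beta> \<gamma> ?Y"
    using p q by (auto intro: is_board_board_of)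
  have "finite (white ?Y)" "finite (black ?X)" using X Y by (auto simp: is_board_def)
  \<comment> \<open>Elements of \<open>K \<beta>\<close> are diagonal, so the red component
    determines \<open>h j\<close>.\<close>
  from eventually_weak_zero_separated[OF assms(5) this, of Red]
  show ?thesis
  proof (rule eventually_mono)
    fix j
    assume sep: "\<forall>k\<in>white ?Y. \<forall>m\<in>black ?X. k > \<beta> \<longrightarrow> m > \<beta> \<longrightarrow> h j Red k \<noteq> m"
    have "h j \<in> K \<beta>" using assms(5) by (simp add: weak_zero_def)
    then obtain s where s: "s \<in> S_inf \<beta>" "h j = (\<lambda>c. s)" by (auto simp: K_def)
    let ?g = "\<lambda>c. p c \<circ> s \<circ> q c"
    have g: "p \<otimes>\<^bsub>GG\<^esub> h j \<otimes>\<^bsub>GG\<^esub> q = ?g" by (simp add: GG_def s(2))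
    have "h j \<in> carrier GG" using K_subset[OF s(1)] s(2) by simp
    then have gc: "?g \<in> carrier GG"
      using p q monoid.m_closed[OF group.is_monoid[OF group_GG]] unfolding g[symmetric] by blast
    \<comment> \<open>The weak zero separates only from numbers above \<open>\<beta>\<close>. The
      image \<open>s w\<close> is one of them: a number in \<open>{1..\<beta>}\<close> is fixed by
      \<open>s\<close>, hence is not the image of \<open>w\<close>.\<close>
    have "s w \<notin> black ?X" if w: "w \<in> white ?Y" "w > \<beta>" for w
    proof -
      have "s w > \<beta>"
      proof (rule ccontr)
        assume "\<not> s w > \<beta>"
        moreover have "s w \<ge> 1"
          using s(1) w(2) permutes_in_image[of s "{1..}" w] by (simp add: S_inf_def)
        ultimately have "s (s w) = s w" using s(1) by (simp add: S_inf_def)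
        then have "s w = w" using bij_S_inf[OF s(1)] by (metis bij_pointE)
        then show False using w(2) \<open>\<not> s w > \<beta>\<close> by simp
      qed
      then show ?thesis using sep w s(2) by auto
    qed
    then have iso: "board_iso \<alpha> \<gamma> (discard \<alpha> \<gamma> (glue_boards \<beta> ?X ?Y)) (board_of \<alpha> \<gamma> ?g)"
      using board_iso_glue_boards_if_separated[OF p q s(1)] by blast
    have "board_mult \<alpha> \<beta> \<gamma> (coset_board \<alpha> \<beta> A) (coset_board \<beta> \<gamma> B) =
        board_class \<alpha> \<gamma> (discard \<alpha> \<gamma> (glue_boards \<beta> ?X ?Y))"
      unfolding A B coset_board_double_coset[OF p] coset_board_double_coset[OF q]
      by (rule board_mult_board_class[OF X Y])
    also have "\<dots> = coset_board \<alpha> \<gamma> (double_coset \<alpha> \<gamma> ?g)"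
      unfolding coset_board_double_coset[OF gc]
      by (rule board_class_eqI[OF is_board_discard_glue_boards[OF X Y] iso])
    \<comment> \<open>\<open>coset_mult\<close> inverts \<open>coset_board\<close> on double cosets;
      since that map is injective there, equal boards give equal double cosets.\<close>
    finally have "coset_mult \<alpha> \<beta> \<gamma> A B = double_coset \<alpha> \<gamma> ?g"
      using bij_betw_imp_inj_on[OF bij_betw_coset_board] gc
      by (simp add: coset_mult_def double_cosets_def)
    then show "double_coset \<alpha> \<gamma> (p \<otimes>\<^bsub>GG\<^esub> h j \<otimes>\<^bsub>GG\<^esub> q) = coset_mult \<alpha> \<beta> \<gamma> A B"
      using g by simp
  qed
qed

end
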